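(* Let $k\ge s\ge 1$ be integers and let $\tau_1,\dots,\tau_k\in[0,1]$ be distinct abscissae, with interpolatory quadrature weights $\omega_i=\int_0^1\ell_i(t)\,\mathrm{d}t$, $i=1,\dots,k$, where $\ell_i$ is the $i$-th Lagrange polynomial of degree $k-1$ on the nodes $\{\tau_i\}$. Assume that the quadrature formula $(\omega_i,\tau_i)_{i=1}^k$ has order at least $2s$, i.e. it is exact for all polynomials of degree at most $2s-1$. Then the method HBVM$(k,s)$ (defined in the context) has order $p=2s$, whatever the choice of the $s$ fundamental abscissae $c_1,\dots,c_s$ among the $\{\tau_i\}$.
   Context: Let $\hat P_{i-1}$ denote the shifted Legendre polynomial of degree $i-1$ on $[0,1]$ and $P_i(t)=\sqrt{2i-1}\,\hat P_{i-1}(t)$, so that $\int_0^1P_i(t)P_j(t)\,\mathrm{d}t=\delta_{ij}$ and $\deg P_i=i-1$. For the initial value problem $\dot y=f(y)$, $y(t_0)=y_0\in\mathbb R^{2m}$ (in the Hamiltonian setting $f(y)=J\nabla H(y)$ with $J$ a constant skew-symmetric matrix), the method HBVM$(k,s)$ with stepsize $h$ is the Runge--Kutta method with abscissae $\tau_1,\dots,\tau_k$, weights $\omega_1,\dots,\omega_k$ and Butcher matrix $A=\mathcal I_s\mathcal P_s^T\Omega\in\mathbb R^{k\times k}$, where $\Omega=\mathrm{diag}(\omega_1,\dots,\omega_k)$ and $\mathcal I_s,\mathcal P_s\in\mathbb R^{k\times s}$ have entries $(\mathcal I_s)_{ij}=\int_0^{\tau_i}P_j(x)\,\mathrm{d}x$,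 $(\mathcal P_s)_{ij}=P_j(\tau_i)$. Explicitly, the stages satisfy $y_i=y_0+h\sum_{j=1}^s\int_0^{\tau_i}P_j(x)\,\mathrm{d}x\sum_{\ell=1}^k\omega_\ell P_j(\tau_\ell)f(y_\ell)$, $i=1,\dots,k$, and $y_1^{\rm new}=y_0+h\sum_{i=1}^k\omega_if(y_i)$. The abscissae $\{\tau_i\}$ are split into $s$ "fundamental" abscissae $c_1,\dots,c_s$ and $k-s$ "silent" ones; the tableau does not depend on this split. Order $p$ means the local error is $O(h^{p+1})$ for smooth $f$. *)

theory Defs
  imports "HOL-Analysis.Analysis" "HOL-Computational_Algebra.Polynomial" "HOL-Library.Landau_Symbols"
begin

definition shifted_legendre :: "nat \<Rightarrow> real \<Rightarrow> real" where
  "shifted_legendre n t = (\<Sum>j\<le>n. (-1)^(n+j) * real (n choose j) * real ((n+j) choose j) * t^j)"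

text \<open>Normalized basis P_i = sqrt(2i-1) hat P_{i-1}, i >= 1 (orthonormal on [0,1]).\<close>
definition legP :: "nat \<Rightarrow> real \<Rightarrow> real" where
  "legP i t = sqrt (2 * real i - 1) * shifted_legendre (i - 1) t"

definition lagrange_basis :: "nat \<Rightarrow> (nat \<Rightarrow> real) \<Rightarrow> nat \<Rightarrow> real \<Rightarrow> real" where
  "lagrange_basis k tau i t = (\<Prod>j\<in>{1..k}-{i}. (t - tau j) / (tau i - tau j))"

definition quad_weight :: "nat \<Rightarrow> (nat \<Rightarrow> real) \<Rightarrow> nat \<Rightarrow> real" where
  "quad_weight k tau i = integral {0..1} (lagrange_basis k tau i)"

definition quad_exact_upto :: "nat \<Rightarrow> (nat \<Rightarrow> real) \<Rightarrow> nat \<Rightarrow> bool" where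
  "quad_exact_upto k tau d \<longleftrightarrow>
     (\<forall>p :: real poly. degree p \<le> d \<longrightarrow>
        (\<Sum>i=1..k. quad_weight k tau i * poly p (tau i)) = integral {0..1} (poly p))"

text \<open>C-infinity: there is a family D n x [v_1,...,v_n] of iterated derivatives,
  D 0 x [] = f x, each x \<mapsto> D n x vs is continuous and has Frechet derivative
  v \<mapsto> D (n+1) x (v # vs).\<close>
definition smooth :: "('a::euclidean_space \<Rightarrow> 'b::real_normed_vector) \<Rightarrow> bool" where
  "smooth f \<longleftrightarrow> (\<exists>D :: nat \<Rightarrow> 'a \<Rightarrow> 'a list \<Rightarrow> 'b.
      (\<forall>x. D 0 x [] = f x) \<and>
      (\<forall>n vs. length vs = n \<longrightarrow>
          continuous_on UNIV (\<lambda>x. D n x vs) \<and>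
          (\<forall>x. ((\<lambda>z. D n z vs) has_derivative (\<lambda>v. D (Suc n) x (v # vs))) (at x))))"

definition hbvm_stages ::
  "nat \<Rightarrow> nat \<Rightarrow> (nat \<Rightarrow> real) \<Rightarrow> ('a::euclidean_space \<Rightarrow> 'a) \<Rightarrow> 'a \<Rightarrow> real \<Rightarrow> (nat \<Rightarrow> 'a) \<Rightarrow> bool" where
  "hbvm_stages k s tau f y0 h Y \<longleftrightarrow>
     (\<forall>i\<in>{1..k}. Y i = y0 + h *\<^sub>R (\<Sum>j=1..s. integral {0..tau i} (legP j) *\<^sub>R
          (\<Sum>l=1..k. (quad_weight k tau l * legP j (tau l)) *\<^sub>R f (Y l))))"

definition hbvm_step ::
  "nat \<Rightarrow> (nat \<Rightarrow> real) \<Rightarrow> ('a::euclidean_space \<Rightarrow> 'a) \<Rightarrow> 'a \<Rightarrow> real \<Rightarrow> (nat \<Rightarrow> 'a) \<Rightarrow> 'a" where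
  "hbvm_step k tau f y0 h Y = y0 + h *\<^sub>R (\<Sum>i=1..k. quad_weight k tau i *\<^sub>R f (Y i))"

end

theory Submission
  imports Defs
begin

text \<open>
  Exactness of the quadrature and orthonormality of the Legendre polynomials give the method Butcher's
  simplifying assumptions \<open>B(2s)\<close>, \<open>C(s)\<close> and \<open>D(s - 1)\<close>. By \<open>C(s)\<close> and the implicit stage equations
  the stage errors \<open>e\<^sub>i = Y\<^sub>i - y(t0 + h tau\<^sub>i)\<close> are \<open>O(h^(s + 1))\<close>, so the equations may be linearised
  around the exact solution at the cost of \<open>O(h^(2s + 2))\<close>: \<open>e = d + h a A e\<close>, where \<open>d\<close> is the
  defect of the exact solution and \<open>A\<^sub>i = f'(y(t0 + h tau\<^sub>i))\<close>. The step error is then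
  \<open>h w A e = h w A (d + h a A d + h\<^sup>2 a A a A d + \<dots>)\<close>. Expanding \<open>A\<close> in powers of \<open>h tau\<^sub>i\<close>, condition
  \<open>D(s - 1)\<close> shows that each row vector \<open>w A (h a A)^n\<close> is again \<open>w\<^sub>i\<close> times a polynomial in
  \<open>h tau\<^sub>i\<close> up to \<open>O(h^s)\<close>, and \<open>w\<^sub>i tau\<^sub>i^m\<close> annihilates the Taylor coefficients of \<open>d\<close> of order
  below \<open>2s - m\<close>.
\<close>

section \<open>Legendre polynomials and the tableau\<close>

lemma has_integral_poly_pderiv:
  fixes p :: "real poly"
  assumes "a \<le> b"
  shows "(poly (pderiv p) has_integral poly p b - poly p a) {a..b}"
  using assms
  by (intro fundamental_theorem_of_calculus)
    (auto simp flip: has_real_derivative_iff_has_vector_derivative intro: has_field_derivative_at_within)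

lemma integrable_poly: "poly (p :: real poly) integrable_on {a..b}"
  by (intro integrable_continuous_interval continuous_intros)

lemma integral_poly_by_parts:
  fixes p q :: "real poly"
  shows "integral {0..1} (poly (p * pderiv q)) =
    poly p 1 * poly q 1 - poly p 0 * poly q 0 - integral {0..1} (poly (pderiv p * q))"
proof -
  have "integral {0..1} (poly (pderiv (p * q))) = poly (p * q) 1 - poly (p * q) 0"
    by (rule integral_unique, rule has_integral_poly_pderiv) simp
  moreover have "integral {0..1} (poly (pderiv (p * q))) =
      integral {0..1} (poly (p * pderiv q)) + integral {0..1} (poly (pderiv p * q))"
    by (subst integral_add [symmetric])
      (auto simp: pderiv_mult algebra_simps intro!: integral_cong integrable_continuous_interval continuous_intros)
  ultimately show ?thesis by simp
qed

lemma integral_poly_smult: "integral {a..b} (poly (smult c p)) = c * integral {a..b} (poly (p :: real poly))"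
proof -
  have "poly (smult c p) = (\<lambda>t. c * poly p t)"
    by (simp add: fun_eq_iff)
  then show ?thesis
    by simp
qed

lemma integral_poly_sum:
  "integral {a..b} (poly (sum g A)) = (\<Sum>x\<in>A. integral {a..b} (poly (g x :: real poly)))"
proof (cases "finite A")
  case True
  have "poly (sum g A) = (\<lambda>t. \<Sum>x\<in>A. poly (g x) t)"
    by (simp add: poly_sum fun_eq_iff)
  then show ?thesis
    using True integrable_poly by (simp add: integral_sum)
next
  case False
  have "poly 0 = (\<lambda>t :: real. 0 :: real)"
    by (simp add: fun_eq_iff)
  with False show ?thesis
    by simp
qed

lemma integral_poly_monom:
  assumes "0 \<le> x"
  shows "integral {0..x} (poly (monom (1::real) n)) = x ^ Suc n / Suc n"
proof -
  have "pderiv (monom (1 / real (Suc n)) (Suc n)) = monom (1::real) n"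
    by (simp add: pderiv_monom)
  then show ?thesis
    using has_integral_poly_pderiv [OF assms, of "monom (1 / real (Suc n)) (Suc n)"]
    by (simp add: poly_monom integral_unique)
qed

text \<open>The degree bound matters later: it keeps powers of t times integrated basis polynomials
  within the range where the quadrature is exact.\<close>

lemma poly_antiderivative:
  fixes p :: "real poly"
  obtains q where "pderiv q = p" "poly q 0 = 0" "degree q \<le> Suc (degree p)"
proof
  let ?q = "\<Sum>i\<le>degree p. monom (coeff p i / real (Suc i)) (Suc i)"
  have "pderiv ?q = (\<Sum>i\<le>degree p. monom (coeff p i) i)"
    by (simp add: higher_pderiv_sum[of 1, simplified] pderiv_monom)
  then show "pderiv ?q = p"
    by (simp add: poly_as_sum_of_monoms)
  show "poly ?q 0 = 0"
    by (simp add: poly_sum poly_monom)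
  show "degree ?q \<le> Suc (degree p)"
    by (intro degree_sum_le) (auto intro!: order.trans [OF degree_monom_le])
qed

section \<open>Rodrigues' formula and orthogonality on [0,1]\<close>

definition rodrigues :: "nat \<Rightarrow> real poly" where
  "rodrigues n = (pderiv ^^ n) ([:0, -1, 1:] ^ n)"

lemma fact_add_pochhammer: "(fact (j + n) :: real) = fact j * pochhammer (real (Suc j)) n"
  using pochhammer_product'[of "1::real" j n] by (simp add: pochhammer_fact add.commute)

lemma quadratic_power_eq: "[:0, -1, 1 :: real:] ^ n = monom 1 n * [:-1, 1:] ^ n"
proof -
  have "[:0, -1, 1 :: real:] = monom 1 1 * [:-1, 1:]"
    by (simp add: monom_altdef)
  then show ?thesis
    by (simp only: power_mult_distrib monom_power) simp
qed

text \<open>With t^2 - t = t (t - 1), the n-fold derivative moves the coefficient of t^(j+n) to t^j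
  and multiplies it by the rising factorial of j + 1, which is \<open>fact n\<close> times a
  binomial. Up to the factor \<open>fact n\<close> these are the coefficients in
  \<open>shifted_legendre\<close>.\<close>

lemma coeff_rodrigues:
  "coeff (rodrigues n) j = (-1) ^ (n + j) * fact n * real (n choose j) * real ((n + j) choose j)"
proof -
  have *: "coeff ([:-1, 1 :: real:] ^ n) j = (-1) ^ (n + j) * real (n choose j)"
  proof (cases "j \<le> n")
    case True
    have "(-1::real) ^ (n - j) = (-1) ^ (n + j)"
      using True by (simp add: minus_one_power_iff)
    then show ?thesis 
      using coeff_linear_poly_power[OF True, of "-1::real" 1] by (simp)
  next
    case False
    then show ?thesis
      by (simp add: coeff_eq_0 degree_linear_power)
  qed
  have "coeff (monom 1 n * [:-1, 1 :: real:] ^ n) (j + n) = coeff ([:-1, 1 :: real:] ^ n) j"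
    by (simp add: coeff_monom_mult)
  moreover have "pochhammer (real (Suc j)) n = fact n * real ((n + j) choose j)"
    using fact_add_pochhammer[of j n] by (simp add: binomial_fact add.commute field_simps)
  ultimately show ?thesis
    unfolding rodrigues_def quadratic_power_eq by (simp add: coeff_higher_pderiv * del: of_nat_Suc)
qed

lemma degree_rodrigues: "degree (rodrigues n) = n"
  by (simp add: rodrigues_def degree_higher_pderiv degree_power_eq)

lemma poly_rodrigues: "poly (rodrigues n) t = fact n * shifted_legendre n t"
  by (simp add: poly_altdef degree_rodrigues coeff_rodrigues shifted_legendre_def sum_distrib_left mult_ac)

text \<open>Each use of the product rule costs at most one factor \<open>p\<close>. For p = t^2 - t
  the surviving factors make boundary terms vanish at 0 and 1.\<close>

lemma dvd_higher_pderiv_power: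
  fixes p :: "real poly"
  shows "k \<le> n \<Longrightarrow> p ^ (n - k) dvd (pderiv ^^ k) (p ^ n)"
proof (induction k)
  case (Suc k)
  then obtain r where r: "(pderiv ^^ k) (p ^ n) = p ^ (n - k) * r"
    by (auto simp: dvd_def)
  obtain d where d: "n - k = Suc d"
    using Suc.prems by (metis Suc_diff_Suc Suc_le_lessD)
  then have "n - Suc k = d" by simp
  moreover have "(pderiv ^^ Suc k) (p ^ n) =
      p ^ d * (p * pderiv r + r * smult (of_nat (Suc d)) (pderiv p))"
    unfolding funpow.simps o_apply r d pderiv_mult pderiv_power_Suc by (simp add: algebra_simps)
  ultimately show ?case
    by simp
qed simp

text \<open>Integration by parts \<open>m\<close> times. Every boundary term involves fewer than
  \<open>n\<close> derivatives of the power, so a factor t^2 - t remains and kills it at both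
  endpoints.\<close>

lemma integral_mult_higher_pderiv:
  fixes q :: "real poly"
  assumes "m \<le> n"
  shows "integral {0..1} (poly (q * (pderiv ^^ m) ([:0, -1, 1:] ^ n))) =
    (-1) ^ m * integral {0..1} (poly ((pderiv ^^ m) q * [:0, -1, 1:] ^ n))"
  using assms
proof (induction m arbitrary: q)
  case (Suc m)
  let ?w = "(pderiv ^^ m) ([:0, -1, 1::real:] ^ n)"
  have "[:0, -1, 1:] ^ (n - m) dvd ?w"
    using Suc.prems by (intro dvd_higher_pderiv_power) simp
  then obtain r where "?w = [:0, -1, 1:] ^ (n - m) * r"
    by (auto simp: dvd_def)
  then have "poly ?w 0 = 0" "poly ?w 1 = 0"
    using Suc.prems by (simp_all add: power_0_left)
  then have "integral {0..1} (poly (q * pderiv ?w)) = - integral {0..1} (poly (pderiv q * ?w))"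
    by (simp only: integral_poly_by_parts)
  also have "\<dots> = (-1) ^ Suc m * integral {0..1} (poly ((pderiv ^^ m) (pderiv q) * [:0, -1, 1:] ^ n))"
    using Suc.prems by (simp add: Suc.IH del: poly_mult)
  finally show ?case
    by (simp only: funpow.simps(2) o_apply funpow_swap1)
qed simp

text \<open>Euler's Beta integral at integers. One integration by parts trades a factor 1 - t for a
  factor t, hence the induction on \<open>n\<close> with \<open>m\<close> arbitrary.\<close>

lemma beta_integral:
  "integral {0..1} (poly (monom 1 m * [:1, -1 :: real:] ^ n)) = fact m * fact n / fact (m + n + 1)"
proof (induction n arbitrary: m)
  case 0
  show ?case
    using integral_poly_monom[of 1 m] by simp
next
  case (Suc n)
  let ?q = "monom (1 / real (Suc m)) (Suc m)"
  have q: "pderiv ?q = monom 1 m"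
    by (simp add: pderiv_monom)
  have "pderiv ([:1, -1 :: real:] ^ Suc n) * ?q =
      smult (- (real (Suc n) / real (Suc m))) (monom 1 (Suc m) * [:1, -1:] ^ n)"
  proof -
    have "?q = smult (1 / real (Suc m)) (monom 1 (Suc m))"
      by (simp add: smult_monom)
    then show ?thesis
      unfolding pderiv_power_Suc by (simp add: pderiv_pCons mult.commute)
  qed
  then have "integral {0..1} (poly ([:1, -1:] ^ Suc n * pderiv ?q)) =
      real (Suc n) / real (Suc m) * integral {0..1} (poly (monom 1 (Suc m) * [:1, -1:] ^ n))"
    by (simp only: integral_poly_by_parts integral_poly_smult) (simp add: poly_monom)
  moreover have "real (Suc n) / real (Suc m) * (fact (Suc m) * fact n / fact (Suc m + n + 1)) =
      fact m * fact (Suc n) / fact (m + Suc n + 1)"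
    by (simp add: divide_simps)
  ultimately show ?case
    unfolding q Suc.IH by (simp only: mult.commute)
qed

text \<open>All \<open>n\<close> derivatives are moved onto \<open>q\<close>, whose degree is too
  small to survive them.\<close>

lemma rodrigues_orthogonal:
  assumes "degree q < n"
  shows "integral {0..1} (poly (q * rodrigues n)) = 0"
proof -
  have "(pderiv ^^ n) q = 0"
    using assms by (simp add: poly_eq_iff coeff_higher_pderiv coeff_eq_0)
  moreover have "poly 0 = (\<lambda>t :: real. 0 :: real)"
    by (simp add: fun_eq_iff)
  ultimately show ?thesis
    by (simp add: rodrigues_def integral_mult_higher_pderiv del: poly_mult)
qed

text \<open>Moving \<open>n\<close> derivatives onto the other factor of degree \<open>n\<close>
  leaves the constant \<open>fact (2 * n)\<close>, and the remaining integral is a Beta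
  integral.\<close>

lemma rodrigues_norm:
  "integral {0..1} (poly (rodrigues n * rodrigues n)) = (fact n)\<^sup>2 / real (2 * n + 1)"
proof -
  let ?w = "[:0, -1, 1 :: real:] ^ n"
  have lead: "coeff (rodrigues n) n = fact (2 * n) / fact n"
    unfolding coeff_rodrigues by (simp add: binomial_fact mult_2)
  have "pochhammer 1 n * coeff (rodrigues n) n = fact (2 * n)"
    by (simp add: lead flip: pochhammer_fact)
  then have higher: "(pderiv ^^ n) (rodrigues n) = [:fact (2 * n):]"
    by (auto simp: poly_eq_iff coeff_higher_pderiv coeff_pCons coeff_eq_0 degree_rodrigues split: nat.split)
  \<comment> \<open>The sign between (t^2 - t)^n and t^n (1 - t)^n cancels the one produced by the
    integrations by parts.\<close>
  have "[:1, -1 :: real:] ^ n = smult ((-1) ^ n) ([:-1, 1:] ^ n)"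
    by (simp flip: smult_power)
  then have w: "monom 1 n * [:1, -1:] ^ n = smult ((-1) ^ n) ?w"
    by (simp add: quadratic_power_eq)
  have c: "[:fact (2 * n):] * ?w = smult (fact (2 * n)) ?w"
    by simp
  have "integral {0..1} (poly (rodrigues n * rodrigues n)) =
     (-1) ^ n * integral {0..1} (poly ((pderiv ^^ n) (rodrigues n) * ?w))"
    using integral_mult_higher_pderiv[of n n "rodrigues n"]
    by (simp only: rodrigues_def[of n, symmetric])
  also have "(-1) ^ n * integral {0..1} (poly ((pderiv ^^ n) (rodrigues n) * ?w)) =
      fact (2 * n) * integral {0..1} (poly (smult ((-1) ^ n) ?w))"
    by (simp only: higher c integral_poly_smult mult.left_commute)
  also have "\<dots> = fact (2 * n) * (fact n * fact n / fact (n + n + 1))"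
    by (simp only: w[symmetric] beta_integral)
  also have "\<dots> = (fact n)\<^sup>2 / real (2 * n + 1)"
  proof -
    have F: "(fact (n + n + 1) :: real) = real (2 * n + 1) * fact (2 * n)"
      by (simp add: distrib_right flip: mult_2)
    show ?thesis
      unfolding F power2_eq_square by (simp add: divide_simps del: of_nat_add of_nat_Suc of_nat_mult)
  qed
  finally show ?thesis .
qed

section \<open>Normalised Legendre polynomials as an orthonormal basis\<close>

definition legpoly :: "nat \<Rightarrow> real poly" where
  "legpoly i = smult (sqrt (2 * real i - 1) / fact (i - 1)) (rodrigues (i - 1))"

lemma poly_legpoly: "poly (legpoly i) = legP i"
  by (simp add: fun_eq_iff legpoly_def poly_rodrigues legP_def)

lemma degree_legpoly: "1 \<le> i \<Longrightarrow> degree (legpoly i) = i - 1"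
  by (simp add: legpoly_def degree_rodrigues)

lemma legpoly_orthonormal:
  assumes "1 \<le> i" "1 \<le> j"
  shows "integral {0..1} (poly (legpoly i * legpoly j)) = (if i = j then 1 else 0)"
proof -
  have less: "integral {0..1} (poly (legpoly i * legpoly j)) = 0" if "i < j" "1 \<le> i" for i j
    using that rodrigues_orthogonal[of "rodrigues (i - 1)" "j - 1"]
    by (simp add: legpoly_def degree_rodrigues integral_poly_smult del: poly_mult poly_smult)
  have eq: "integral {0..1} (poly (legpoly i * legpoly i)) = 1"
  proof -
    have "real (2 * (i - 1) + 1) = 2 * real i - 1"
      using assms by (simp add: of_nat_diff)
    then show ?thesis
      using assms rodrigues_norm[of "i - 1"]
      by (simp add: legpoly_def integral_poly_smult power2_eq_square del: poly_mult poly_smult)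
  qed
  show ?thesis
    using less[of i j] less[of j i] eq assms
    by (cases i j rule: linorder_cases) (auto simp del: poly_mult simp: mult.commute)
qed

text \<open>\<open>legpoly (Suc n)\<close> has degree exactly \<open>n\<close>, so a multiple of it
  removes the top coefficient of \<open>q\<close> and the induction continues with the rest.\<close>

lemma legpoly_span:
  fixes q :: "real poly"
  assumes "degree q < n"
  obtains c where "q = (\<Sum>j=1..n. smult (c j) (legpoly j))"
  using assms
proof (induction n arbitrary: q thesis)
  case (Suc n)
  let ?L = "legpoly (Suc n)"
  have L: "degree ?L = n"
    by (simp add: degree_legpoly)
  have L0: "coeff ?L n \<noteq> 0"
    using degree_rodrigues[of n] leading_coeff_0_iff[of "rodrigues n"]
    by (auto simp: legpoly_def coeff_rodrigues)
  define c0 where "c0 = coeff q n / coeff ?L n"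
  let ?r = "q - smult c0 ?L"
  have r: "coeff ?r i = 0" if "i \<ge> n" for i
    using that L0 L Suc.prems(2) by (cases "i = n") (auto simp: c0_def coeff_eq_0)
  show ?case
  proof (cases "n = 0")
    case True
    then have "?r = 0"
      using r by (simp add: poly_eq_iff)
    then show ?thesis
      using True Suc.prems(1)[of "\<lambda>_. c0"] by simp
  next
    case False
    then have "degree ?r < n"
      using r by (metis degree_0 gr0I leading_coeff_0_iff not_le)
    then obtain c where c: "?r = (\<Sum>j=1..n. smult (c j) (legpoly j))"
      using Suc.IH by blast
    have "(\<Sum>j=1..n. smult ((c(Suc n := c0)) j) (legpoly j)) = ?r"
      unfolding c by (intro sum.cong) auto
    then show ?thesis
      by (intro Suc.prems(1)[of "c(Suc n := c0)"]) simp
  qed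
qed simp

text \<open>Some coefficients exist by \<open>legpoly_span\<close>; pairing with
  \<open>legpoly j\<close> and orthonormality identifies them as the Fourier coefficients.\<close>

lemma legpoly_expansion:
  fixes q :: "real poly"
  assumes "degree q < n"
  shows "q = (\<Sum>j=1..n. smult (integral {0..1} (poly (q * legpoly j))) (legpoly j))"
proof -
  obtain c where c: "q = (\<Sum>j=1..n. smult (c j) (legpoly j))"
    using legpoly_span[OF assms] .
  have "integral {0..1} (poly (q * legpoly j)) = c j" if "j \<in> {1..n}" for j
  proof -
    have "q * legpoly j = (\<Sum>i=1..n. smult (c i) (legpoly i * legpoly j))"
      by (subst c) (simp add: sum_distrib_right)
    then have "integral {0..1} (poly (q * legpoly j)) = (\<Sum>i=1..n. c i * (if i = j then 1 else 0))"
      using that by (simp add: integral_poly_sum integral_poly_smult legpoly_orthonormal del: poly_mult poly_smult)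
    then show ?thesis
      using that by (simp add: if_distrib cong: if_cong)
  qed
  then have "(\<Sum>j=1..n. smult (integral {0..1} (poly (q * legpoly j))) (legpoly j)) =
      (\<Sum>j=1..n. smult (c j) (legpoly j))"
    by (intro sum.cong) auto
  then show ?thesis
    using c by metis
qed

section \<open>The Butcher matrix and its simplifying assumptions\<close>

definition hbvm_matrix :: "nat \<Rightarrow> nat \<Rightarrow> (nat \<Rightarrow> real) \<Rightarrow> nat \<Rightarrow> nat \<Rightarrow> real" where
  "hbvm_matrix k s tau i l =
    (\<Sum>j=1..s. integral {0..tau i} (legP j) * (quad_weight k tau l * legP j (tau l)))"

lemma quad_exact_power:
  assumes "quad_exact_upto k tau d" "m \<le> d"
  shows "(\<Sum>i=1..k. quad_weight k tau i * tau i ^ m) = 1 / Suc m"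
proof -
  have "degree (monom (1::real) m) \<le> d"
    using assms(2) degree_monom_le order.trans by blast
  then show ?thesis
    using assms(1) integral_poly_monom[of 1 m] by (fastforce simp: quad_exact_upto_def poly_monom)
qed

text \<open>Condition \<open>C(s)\<close>. The products t^m times \<open>legpoly j\<close> have
  degree at most 2s - 2, so the quadrature sums are the exact Fourier coefficients of t^m; the sum
  over \<open>j\<close> is then the expansion of t^m, integrated from 0 to
  \<open>tau i\<close>.\<close>

lemma hbvm_matrix_power:
  assumes exact: "quad_exact_upto k tau (2 * s - 1)" and "0 \<le> tau i" "m < s"
  shows "(\<Sum>l=1..k. hbvm_matrix k s tau i l * tau l ^ m) = tau i ^ Suc m / Suc m"
proof -
  let ?q = "monom (1::real) m"
  let ?I = "\<lambda>j. integral {0..tau i} (legP j)"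
  have quad: "(\<Sum>l=1..k. quad_weight k tau l * (legP j (tau l) * tau l ^ m)) =
      integral {0..1} (poly (?q * legpoly j))" if "j \<in> {1..s}" for j
  proof -
    have "degree (?q * legpoly j) \<le> m + (j - 1)"
      using that by (intro order.trans[OF degree_mult_le] add_mono degree_monom_le) (simp add: degree_legpoly)
    then have "degree (?q * legpoly j) \<le> 2 * s - 1"
      using that \<open>m < s\<close> by auto
    then show ?thesis
      using exact by (auto simp: quad_exact_upto_def poly_monom poly_legpoly mult_ac)
  qed
  have "(\<Sum>l=1..k. hbvm_matrix k s tau i l * tau l ^ m) =
      (\<Sum>j=1..s. ?I j * (\<Sum>l=1..k. quad_weight k tau l * (legP j (tau l) * tau l ^ m)))"
    unfolding hbvm_matrix_def sum_distrib_right sum_distrib_left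
    by (subst sum.swap) (simp add: mult_ac)
  also have "\<dots> = (\<Sum>j=1..s. integral {0..1} (poly (?q * legpoly j)) * integral {0..tau i} (poly (legpoly j)))"
    by (intro sum.cong) (simp_all only: quad poly_legpoly mult.commute)
  also have "\<dots> = integral {0..tau i} (poly (\<Sum>j=1..s. smult (integral {0..1} (poly (?q * legpoly j))) (legpoly j)))"
    by (simp only: integral_poly_sum integral_poly_smult)
  also have "\<dots> = integral {0..tau i} (poly ?q)"
    using \<open>m < s\<close> by (subst legpoly_expansion[of ?q s, symmetric]) (simp_all add: degree_monom_eq)
  finally show ?thesis
    using integral_poly_monom[OF \<open>0 \<le> tau i\<close>] by simp
qed

text \<open>Condition \<open>D(s - 1)\<close>. The sum over \<open>i\<close> is an exact quadrature
  of t^m times an integrated basis polynomial. Integration by parts turns it into a Fourier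
  coefficient of \<open>r\<close>, and the sum over \<open>j\<close> rebuilds \<open>r\<close> at
  \<open>tau l\<close>.\<close>

lemma hbvm_matrix_weight_power:
  assumes exact: "quad_exact_upto k tau (2 * s - 1)" and tau: "\<And>i. i \<in> {1..k} \<Longrightarrow> 0 \<le> tau i"
    and m: "Suc m < s"
  shows "(\<Sum>i=1..k. quad_weight k tau i * tau i ^ m * hbvm_matrix k s tau i l) =
    quad_weight k tau l * (1 - tau l ^ Suc m) / Suc m"
proof -
  let ?q = "monom (1::real) m"
  \<comment> \<open>The antiderivative of -t^m that vanishes at 1. As \<open>I j\<close> vanishes at
    0, neither boundary term survives. Its degree m + 1 is below \<open>s\<close>, so its expansion
    in \<open>s\<close> basis polynomials is complete.\<close>
  define r where "r = smult (1 / real (Suc m)) (1 - monom 1 (Suc m))"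
  have r: "pderiv r = - ?q" "poly r 1 = 0"
    by (simp_all add: r_def pderiv_smult pderiv_diff pderiv_monom smult_monom poly_monom)
  have deg_r: "degree r < s"
    unfolding r_def using m
    by (intro le_less_trans[OF degree_smult_le] degree_diff_less) (auto intro: le_less_trans[OF degree_monom_le])
  have "\<forall>j. \<exists>q. pderiv q = legpoly j \<and> poly q 0 = 0 \<and> degree q \<le> Suc (degree (legpoly j))"
    by (metis poly_antiderivative)
  then obtain I where I: "\<And>j. pderiv (I j) = legpoly j" "\<And>j. poly (I j) 0 = 0"
      "\<And>j. degree (I j) \<le> Suc (degree (legpoly j))"
    by metis
  have int: "integral {0..tau i} (legP j) = poly (I j) (tau i)" if "i \<in> {1..k}" for i j
    using has_integral_poly_pderiv[OF tau[OF that], of "I j"]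
    by (simp add: I poly_legpoly integral_unique)
  have quad: "(\<Sum>i=1..k. quad_weight k tau i * (tau i ^ m * poly (I j) (tau i))) =
      integral {0..1} (poly (r * legpoly j))" if "j \<in> {1..s}" for j
  proof -
    have "degree (?q * I j) \<le> m + j"
      using that I(3)[of j]
      by (intro order.trans[OF degree_mult_le] add_mono degree_monom_le) (simp add: degree_legpoly)
    then have "degree (?q * I j) \<le> 2 * s - 1"
      using that m by auto
    then have "(\<Sum>i=1..k. quad_weight k tau i * poly (?q * I j) (tau i)) = integral {0..1} (poly (?q * I j))"
      using exact unfolding quad_exact_upto_def by blast
    moreover have "integral {0..1} (poly (r * pderiv (I j))) = - integral {0..1} (poly (- ?q * I j))"
      using integral_poly_by_parts[of r "I j"] by (simp add: r I del: poly_mult)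
    moreover have "integral {0..1} (poly (- ?q * I j)) = - integral {0..1} (poly (?q * I j))"
      using integral_poly_smult[of 0 1 "-1" "?q * I j"] by simp
    ultimately show ?thesis
      by (simp add: I poly_monom mult_ac)
  qed
  have "(\<Sum>i=1..k. quad_weight k tau i * tau i ^ m * hbvm_matrix k s tau i l) =
      (\<Sum>i=1..k. \<Sum>j=1..s. quad_weight k tau l * (legP j (tau l) * (quad_weight k tau i * (tau i ^ m * poly (I j) (tau i)))))"
    unfolding hbvm_matrix_def sum_distrib_left
    by (intro sum.cong refl) (simp add: int mult_ac)
  also have "\<dots> = quad_weight k tau l * (\<Sum>j=1..s. legP j (tau l) *
      (\<Sum>i=1..k. quad_weight k tau i * (tau i ^ m * poly (I j) (tau i))))"
    unfolding sum_distrib_left by (rule sum.swap)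
  also have "\<dots> = quad_weight k tau l * (\<Sum>j=1..s. integral {0..1} (poly (r * legpoly j)) * poly (legpoly j) (tau l))"
    by (rule arg_cong[where f = "\<lambda>t. quad_weight k tau l * t"], rule sum.cong)
      (simp_all only: quad poly_legpoly mult.commute)
  also have "\<dots> = quad_weight k tau l *
      poly (\<Sum>j=1..s. smult (integral {0..1} (poly (r * legpoly j))) (legpoly j)) (tau l)"
    by (simp only: poly_sum poly_smult)
  also have "\<dots> = quad_weight k tau l * poly r (tau l)"
    by (simp only: legpoly_expansion[OF deg_r, symmetric])
  finally show ?thesis
    by (simp add: r_def poly_monom)
qed

section \<open>Orders of vanishing and Taylor expansions\<close>

text \<open>Big-O of h^n along a filter. Expansions of the solution are stated on
  \<open>nhds 0\<close>, while the stages are controlled only on \<open>at 0\<close>, so the filter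
  is a parameter.\<close>

definition order_ge :: "real filter \<Rightarrow> nat \<Rightarrow> (real \<Rightarrow> 'b::real_normed_vector) \<Rightarrow> bool" where
  "order_ge F n u \<longleftrightarrow> (\<exists>C. \<forall>\<^sub>F h in F. norm (u h) \<le> C * \<bar>h\<bar> ^ n)"

lemma order_geI: "(\<forall>\<^sub>F h in F. norm (u h) \<le> C * \<bar>h\<bar> ^ n) \<Longrightarrow> order_ge F n u"
  by (auto simp: order_ge_def)

lemma order_geE:
  assumes "order_ge F n u"
  obtains C where "C \<ge> 0" "\<forall>\<^sub>F h in F. norm (u h) \<le> C * \<bar>h\<bar> ^ n"
proof -
  obtain C where C: "\<forall>\<^sub>F h in F. norm (u h) \<le> C * \<bar>h\<bar> ^ n"
    using assms by (auto simp: order_ge_def)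
  have "\<forall>\<^sub>F h in F. norm (u h) \<le> \<bar>C\<bar> * \<bar>h\<bar> ^ n"
    using C by eventually_elim (smt (verit) mult_right_mono zero_le_power abs_ge_zero abs_ge_self)
  then show ?thesis
    using that[of "\<bar>C\<bar>"] by simp
qed

lemma order_ge_bound:
  assumes "order_ge F n u" "\<forall>\<^sub>F h in F. norm (v h) \<le> K * norm (u h)" "K \<ge> 0"
  shows "order_ge F n v"
proof -
  obtain C where "\<forall>\<^sub>F h in F. norm (u h) \<le> C * \<bar>h\<bar> ^ n"
    using assms(1) by (auto simp: order_ge_def)
  with assms(2) have "\<forall>\<^sub>F h in F. norm (v h) \<le> (K * C) * \<bar>h\<bar> ^ n"
  proof eventually_elim
    case (elim h)
    then have "norm (v h) \<le> K * (C * \<bar>h\<bar> ^ n)"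
      using \<open>K \<ge> 0\<close> by (meson mult_left_mono order.trans)
    then show ?case by (simp add: mult.assoc)
  qed
  then show ?thesis by (rule order_geI)
qed

lemma order_ge_cong:
  assumes "order_ge F n u" "\<forall>\<^sub>F h in F. u h = v h"
  shows "order_ge F n v"
  using assms(2) by (intro order_ge_bound[OF assms(1), of _ 1]) (auto elim: eventually_mono)

lemma order_ge_filter_mono: "order_ge G n u \<Longrightarrow> F \<le> G \<Longrightarrow> order_ge F n u"
  by (auto simp: order_ge_def intro: filter_leD)

text \<open>Powers decrease in the exponent only where |h| is at most 1, hence the restriction to
  filters concentrated at 0.\<close>

lemma order_ge_mono:
  assumes "order_ge F m u" "n \<le> m" and F: "F \<le> nhds 0"
  shows "order_ge F n u"
proof -
  obtain C where "C \<ge> 0" and C: "\<forall>\<^sub>F h in F. norm (u h) \<le> C * \<bar>h\<bar> ^ m"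
    using assms(1) by (rule order_geE)
  have "\<forall>\<^sub>F h in nhds 0. \<bar>h\<bar> < (1::real)"
    unfolding eventually_nhds_metric by (intro exI[of _ 1]) auto
  then have "\<forall>\<^sub>F h in F. \<bar>h\<bar> < 1"
    using F by (rule filter_leD[rotated])
  with C have "\<forall>\<^sub>F h in F. norm (u h) \<le> C * \<bar>h\<bar> ^ n"
  proof (eventually_elim)
    case (elim h)
    then show ?case
      using \<open>C \<ge> 0\<close> power_decreasing[OF \<open>n \<le> m\<close>, of "\<bar>h\<bar>"] mult_left_mono[of "\<bar>h\<bar> ^ m" "\<bar>h\<bar> ^ n" C]
      by linarith
  qed
  then show ?thesis by (rule order_geI)
qed

lemma order_ge_zero [simp]: "order_ge F n (\<lambda>h. 0)"
  by (rule order_geI[where C = 0]) simp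

lemma order_ge_add:
  assumes "order_ge F n u" "order_ge F n v"
  shows "order_ge F n (\<lambda>h. u h + v h)"
proof -
  obtain C K where "\<forall>\<^sub>F h in F. norm (u h) \<le> C * \<bar>h\<bar> ^ n" "\<forall>\<^sub>F h in F. norm (v h) \<le> K * \<bar>h\<bar> ^ n"
    using assms by (auto simp: order_ge_def)
  then have "\<forall>\<^sub>F h in F. norm (u h + v h) \<le> (C + K) * \<bar>h\<bar> ^ n"
    by eventually_elim (simp add: distrib_right norm_triangle_mono)
  then show ?thesis by (rule order_geI)
qed

lemma order_ge_minus: "order_ge F n u \<Longrightarrow> order_ge F n (\<lambda>h. - u h)"
  by (simp add: order_ge_def)

lemma order_ge_diff: "order_ge F n u \<Longrightarrow> order_ge F n v \<Longrightarrow> order_ge F n (\<lambda>h. u h - v h)"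
  using order_ge_add[of F n u "\<lambda>h. - v h"] by (simp add: order_ge_minus)

lemma order_ge_sum:
  "(\<And>i. i \<in> A \<Longrightarrow> order_ge F n (u i)) \<Longrightarrow> order_ge F n (\<lambda>h. \<Sum>i\<in>A. u i h)"
  by (induction A rule: infinite_finite_induct) (auto intro: order_ge_add)

lemma order_ge_scaleR:
  assumes "order_ge F m a" "order_ge F n u"
  shows "order_ge F (m + n) (\<lambda>h. a h *\<^sub>R u h)"
proof -
  obtain C where C: "C \<ge> 0" "\<forall>\<^sub>F h in F. norm (a h) \<le> C * \<bar>h\<bar> ^ m"
    using assms(1) by (rule order_geE)
  obtain K where "K \<ge> 0" and K: "\<forall>\<^sub>F h in F. norm (u h) \<le> K * \<bar>h\<bar> ^ n"
    using assms(2) by (rule order_geE)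
  from C(2) K have "\<forall>\<^sub>F h in F. norm (a h *\<^sub>R u h) \<le> (C * K) * \<bar>h\<bar> ^ (m + n)"
  proof eventually_elim
    case (elim h)
    then have "\<bar>a h\<bar> * norm (u h) \<le> (C * \<bar>h\<bar> ^ m) * (K * \<bar>h\<bar> ^ n)"
      using C(1) by (intro mult_mono) auto
    then show ?case by (simp add: power_add mult_ac)
  qed
  then show ?thesis by (rule order_geI)
qed

lemma order_ge_mult:
  fixes a u :: "real \<Rightarrow> real"
  shows "order_ge F m a \<Longrightarrow> order_ge F n u \<Longrightarrow> order_ge F (m + n) (\<lambda>h. a h * u h)"
  using order_ge_scaleR[of F m a n u] by simp

lemma order_ge_const [simp]: "order_ge F 0 (\<lambda>h. c)"
  by (rule order_geI[where C = "norm c"]) simp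

lemma order_ge_scaleR_const: "order_ge F n u \<Longrightarrow> order_ge F n (\<lambda>h. c *\<^sub>R u h)"
  using order_ge_scaleR[of F 0 "\<lambda>_. c" n u] by simp

lemma order_ge_power: "order_ge F n (\<lambda>h. h ^ n)"
  by (rule order_geI[where C = 1]) (simp add: power_abs)

lemma order_ge_power_scaleR: "order_ge F n (\<lambda>h. (h ^ n * b) *\<^sub>R c)"
  using order_ge_scaleR[OF order_ge_power[of F n] order_ge_const[of F "b *\<^sub>R c"]] by simp

lemma order_ge_bounded_linear:
  assumes "bounded_linear L" "order_ge F n u"
  shows "order_ge F n (\<lambda>h. L (u h))"
proof -
  obtain K where "K \<ge> 0" "\<And>x. norm (L x) \<le> norm x * K"
    using bounded_linear.nonneg_bounded[OF assms(1)] by blast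
  then show ?thesis
    by (intro order_ge_bound[OF assms(2), of _ K]) (simp_all add: mult.commute)
qed

text \<open>Stated for \<open>nhds 0\<close> because an abscissa \<open>c\<close> may be 0; then the
  argument \<open>h * c\<close> is constantly 0, a point that \<open>at 0\<close> does not
  see.\<close>

lemma order_ge_compose_mult:
  assumes "order_ge (nhds 0) n u"
  shows "order_ge (nhds 0) n (\<lambda>h. u (h * c))"
proof -
  obtain C where "\<forall>\<^sub>F x in nhds 0. norm (u x) \<le> C * \<bar>x\<bar> ^ n"
    using assms by (auto simp: order_ge_def)
  moreover have "filterlim (\<lambda>h::real. h * c) (nhds 0) (nhds 0)"
    using tendsto_mult_left_zero[of "\<lambda>h. h" "nhds 0" c] by (simp add: tendsto_def filterlim_ident)
  ultimately have "\<forall>\<^sub>F h in nhds 0. norm (u (h * c)) \<le> C * \<bar>h * c\<bar> ^ n"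
    by (auto simp: filterlim_iff)
  then show ?thesis
    by (intro order_geI[where C = "C * \<bar>c\<bar> ^ n"]) (simp add: abs_mult power_mult_distrib mult_ac)
qed

lemma order_ge_tendsto:
  assumes "(u \<longlongrightarrow> l) F"
  shows "order_ge F 0 u"
proof -
  have "\<forall>\<^sub>F h in F. norm (u h - l) < 1"
    using assms by (simp add: tendsto_iff dist_norm)
  then have "\<forall>\<^sub>F h in F. norm (u h) \<le> (1 + norm l) * \<bar>h\<bar> ^ 0"
  proof eventually_elim
    case (elim h)
    then show ?case using norm_triangle_ineq2[of "u h" l] by simp
  qed
  then show ?thesis by (rule order_geI)
qed

lemma at_0_le_nhds_0: "at (0::real) \<le> nhds 0"
  by (simp add: at_within_def)

text \<open>A polynomial of degree below \<open>n\<close> plus a remainder of order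
  \<open>n\<close>, with no mention of derivatives. This form is closed under products and, gaining
  one order, under integration.\<close>

definition taylor :: "nat \<Rightarrow> (real \<Rightarrow> 'b::real_normed_vector) \<Rightarrow> bool" where
  "taylor n u \<longleftrightarrow> (\<exists>c. order_ge (nhds 0) n (\<lambda>x. u x - (\<Sum>m<n. x ^ m *\<^sub>R c m)))"

lemma taylor_remainder: "order_ge (nhds 0) n u \<Longrightarrow> taylor n u"
  unfolding taylor_def by (intro exI[of _ "\<lambda>_. 0"]) simp

lemma taylor_monomial: "taylor n (\<lambda>x. x ^ m *\<^sub>R c)"
proof (cases "m < n")
  case True
  then have "(\<Sum>p<n. x ^ p *\<^sub>R (if p = m then c else 0)) = x ^ m *\<^sub>R c" for x :: real
    by (simp add: if_distrib cong: if_cong)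
  then show ?thesis
    unfolding taylor_def by (intro exI[of _ "\<lambda>p. if p = m then c else 0"]) simp
next
  case False
  then show ?thesis
    using order_ge_power_scaleR[of "nhds 0" m 1 c]
    by (intro taylor_remainder) (auto intro: order_ge_mono)
qed

lemma taylor_add:
  assumes "taylor n u" "taylor n v"
  shows "taylor n (\<lambda>x. u x + v x)"
proof -
  obtain c d where "order_ge (nhds 0) n (\<lambda>x. u x - (\<Sum>m<n. x ^ m *\<^sub>R c m))"
    "order_ge (nhds 0) n (\<lambda>x. v x - (\<Sum>m<n. x ^ m *\<^sub>R d m))"
    using assms by (auto simp: taylor_def)
  from order_ge_add[OF this] show ?thesis
    unfolding taylor_def
    by (intro exI[of _ "\<lambda>m. c m + d m"]) (simp add: algebra_simps sum.distrib)
qed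

lemma taylor_sum:
  "(\<And>i. i \<in> A \<Longrightarrow> taylor n (u i)) \<Longrightarrow> taylor n (\<lambda>x. \<Sum>i\<in>A. u i x)"
  by (induction A rule: infinite_finite_induct) (auto intro: taylor_add taylor_remainder)

lemma taylor_bounded:
  assumes "taylor n u"
  shows "order_ge (nhds 0) 0 u"
proof -
  obtain c where c: "order_ge (nhds 0) n (\<lambda>x. u x - (\<Sum>m<n. x ^ m *\<^sub>R c m))"
    using assms by (auto simp: taylor_def)
  have "order_ge (nhds 0) 0 (\<lambda>x. (\<Sum>m<n. x ^ m *\<^sub>R c m))"
    using order_ge_power_scaleR[of "nhds 0" _ 1]
    by (intro order_ge_sum) (auto intro: order_ge_mono)
  from order_ge_add[OF order_ge_mono[OF c, of 0] this] show ?thesis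
    by simp
qed

lemma taylor_bounded_linear:
  assumes "bounded_linear L" "taylor n u"
  shows "taylor n (\<lambda>x. L (u x))"
proof -
  interpret L: bounded_linear L by fact
  obtain c where "order_ge (nhds 0) n (\<lambda>x. u x - (\<Sum>m<n. x ^ m *\<^sub>R c m))"
    using assms by (auto simp: taylor_def)
  from order_ge_bounded_linear[OF assms(1) this] show ?thesis
    unfolding taylor_def by (intro exI[of _ "\<lambda>m. L (c m)"]) (simp add: L.diff L.sum L.scaleR)
qed

text \<open>With truncations p and q the product is (a - p) u + p (u - q) + p q. Monomials of p q of
  degree \<open>n\<close> or more are absorbed into the remainder by
  \<open>taylor_monomial\<close>.\<close>

lemma taylor_scaleR:
  fixes a :: "real \<Rightarrow> real"
  assumes "taylor n a" "taylor n u"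
  shows "taylor n (\<lambda>x. a x *\<^sub>R u x)"
proof -
  obtain c d where c: "order_ge (nhds 0) n (\<lambda>x. a x - (\<Sum>m<n. x ^ m *\<^sub>R c m))"
    and d: "order_ge (nhds 0) n (\<lambda>x. u x - (\<Sum>m<n. x ^ m *\<^sub>R d m))"
    using assms by (auto simp: taylor_def)
  let ?p = "\<lambda>x. \<Sum>m<n. x ^ m *\<^sub>R c m" and ?q = "\<lambda>x. \<Sum>m<n. x ^ m *\<^sub>R d m"
  have "order_ge (nhds 0) n (\<lambda>x. (a x - ?p x) *\<^sub>R u x)"
    using order_ge_scaleR[OF c taylor_bounded[OF assms(2)]] by simp
  moreover have "taylor n ?p"
    by (intro taylor_sum taylor_monomial)
  then have "order_ge (nhds 0) n (\<lambda>x. ?p x *\<^sub>R (u x - ?q x))"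
    using order_ge_scaleR[OF taylor_bounded d, of n ?p] by simp
  moreover have "taylor n (\<lambda>x. \<Sum>i<n. \<Sum>j<n. x ^ (i + j) *\<^sub>R (c i *\<^sub>R d j))"
    by (intro taylor_sum taylor_monomial)
  moreover have "?p x *\<^sub>R ?q x = (\<Sum>i<n. \<Sum>j<n. x ^ (i + j) *\<^sub>R (c i *\<^sub>R d j))" for x
    by (subst scaleR_sum_left) (simp add: scaleR_sum_right power_add mult_ac)
  ultimately have "taylor n (\<lambda>x. (a x - ?p x) *\<^sub>R u x + ?p x *\<^sub>R (u x - ?q x) + ?p x *\<^sub>R ?q x)"
    by (intro taylor_add) (simp_all add: taylor_remainder)
  then show ?thesis
    by (simp add: algebra_simps)
qed

section \<open>Integrated expansions and expansions along a solution\<close>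

lemma order_ge_integrate:
  fixes g :: "real \<Rightarrow> 'b::real_normed_vector"
  assumes "order_ge (nhds 0) n g'" "\<forall>\<^sub>F x in nhds 0. (g has_vector_derivative g' x) (at x)"
  shows "order_ge (nhds 0) (Suc n) (\<lambda>x. g x - g 0)"
proof -
  obtain C where "C \<ge> 0" and C: "\<forall>\<^sub>F x in nhds 0. norm (g' x) \<le> C * \<bar>x\<bar> ^ n"
    using assms(1) by (rule order_geE)
  obtain d where d: "d > 0"
      "\<And>x. \<bar>x\<bar> < d \<Longrightarrow> norm (g' x) \<le> C * \<bar>x\<bar> ^ n \<and> (g has_vector_derivative g' x) (at x)"
    using eventually_conj[OF C assms(2)] by (auto simp: eventually_nhds_metric)
  have "norm (g x - g 0) \<le> C * \<bar>x\<bar> ^ Suc n" if "\<bar>x\<bar> < d" for x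
  proof -
    have "norm (g x - g 0) \<le> (C * \<bar>x\<bar> ^ n) * norm (x - 0)"
    proof (rule differentiable_bound[of "cball 0 \<bar>x\<bar>" g "\<lambda>t v. v *\<^sub>R g' t"])
      fix t :: real assume "t \<in> cball 0 \<bar>x\<bar>"
      then have t: "\<bar>t\<bar> \<le> \<bar>x\<bar>" by simp
      then show "(g has_derivative (\<lambda>v. v *\<^sub>R g' t)) (at t within cball 0 \<bar>x\<bar>)"
        using d(2)[of t] that by (simp add: has_vector_derivative_def has_derivative_at_withinI)
      have "norm (g' t) \<le> C * \<bar>x\<bar> ^ n"
        using d(2)[of t] that t \<open>C \<ge> 0\<close> power_mono[of "\<bar>t\<bar>" "\<bar>x\<bar>" n]
        by (smt (verit) mult_left_mono)
      then show "onorm (\<lambda>v. v *\<^sub>R g' t) \<le> C * \<bar>x\<bar> ^ n"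
        by (intro onorm_le) (simp add: mult.commute mult_left_mono)
    qed auto
    then show ?thesis by (simp add: mult_ac)
  qed
  then have "\<forall>\<^sub>F x in nhds 0. norm (g x - g 0) \<le> C * \<bar>x\<bar> ^ Suc n"
    unfolding eventually_nhds_metric using d(1) by (auto simp: dist_real_def)
  then show ?thesis by (rule order_geI)
qed

text \<open>The coefficients stay explicit instead of being hidden in \<open>taylor\<close>:
  \<open>quadrature_defect\<close> compares the expansions of a solution and of its derivative term
  by term.\<close>

lemma taylor_integrate_expansion:
  fixes u :: "real \<Rightarrow> 'b::real_normed_vector"
  assumes u': "order_ge (nhds 0) n (\<lambda>x. u' x - (\<Sum>m<n. x ^ m *\<^sub>R c m))"
    and deriv: "\<forall>\<^sub>F x in nhds 0. (u has_vector_derivative u' x) (at x)"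
  shows "order_ge (nhds 0) (Suc n) (\<lambda>x. u x - u 0 - (\<Sum>m<n. (x ^ Suc m / Suc m) *\<^sub>R c m))"
proof -
  let ?q = "\<lambda>x. \<Sum>m<n. (x ^ Suc m / real (Suc m)) *\<^sub>R c m"
  have q: "(?q has_vector_derivative (\<Sum>m<n. x ^ m *\<^sub>R c m)) (at x)" for x :: real
  proof (intro has_vector_derivative_sum)
    fix m
    have "((\<lambda>x. x ^ Suc m / real (Suc m)) has_real_derivative x ^ m) (at x)"
      by (rule derivative_eq_intros refl | simp)+
    then show "((\<lambda>x. (x ^ Suc m / real (Suc m)) *\<^sub>R c m) has_vector_derivative x ^ m *\<^sub>R c m) (at x)"
      using has_vector_derivative_scaleR[OF _ has_vector_derivative_const[of "c m"]] by fastforce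
  qed
  have "\<forall>\<^sub>F x in nhds 0. ((\<lambda>x. u x - ?q x) has_vector_derivative u' x - (\<Sum>m<n. x ^ m *\<^sub>R c m)) (at x)"
    using deriv by eventually_elim (intro has_vector_derivative_diff q)
  from order_ge_integrate[OF u' this] show ?thesis
    by (simp add: algebra_simps)
qed

lemma taylor_integrate:
  fixes u :: "real \<Rightarrow> 'b::real_normed_vector"
  assumes "taylor n u'" "\<forall>\<^sub>F x in nhds 0. (u has_vector_derivative u' x) (at x)"
  shows "taylor (Suc n) u"
proof -
  obtain c where "order_ge (nhds 0) n (\<lambda>x. u' x - (\<Sum>m<n. x ^ m *\<^sub>R c m))"
    using assms(1) by (auto simp: taylor_def)
  then have "taylor (Suc n) (\<lambda>x. u x - u 0 - (\<Sum>m<n. (x ^ Suc m / Suc m) *\<^sub>R c m))"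
    by (intro taylor_remainder taylor_integrate_expansion[OF _ assms(2)])
  moreover have "taylor (Suc n) (\<lambda>x. x ^ 0 *\<^sub>R u 0 + (\<Sum>m<n. x ^ Suc m *\<^sub>R ((1 / Suc m) *\<^sub>R c m)))"
    by (intro taylor_add taylor_sum taylor_monomial)
  ultimately have "taylor (Suc n) (\<lambda>x. (u x - u 0 - (\<Sum>m<n. (x ^ Suc m / Suc m) *\<^sub>R c m)) +
      (x ^ 0 *\<^sub>R u 0 + (\<Sum>m<n. x ^ Suc m *\<^sub>R ((1 / Suc m) *\<^sub>R c m))))"
    by (rule taylor_add)
  then show ?thesis
    by simp
qed

lemma linear_eq_sum_Basis:
  fixes L :: "'a::euclidean_space \<Rightarrow> 'b::real_vector"
  assumes "linear L"
  shows "L v = (\<Sum>b\<in>Basis. (v \<bullet> b) *\<^sub>R L b)"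
proof -
  interpret linear L by fact
  show ?thesis
    using sum[of "\<lambda>b. (v \<bullet> b) *\<^sub>R b" Basis] by (simp add: euclidean_representation scaleR)
qed

text \<open>Along the solution, the derivative of \<open>D m (z x) vs\<close> is
  \<open>D (Suc m)\<close> in the moving direction \<open>D 0 (z x) []\<close>. Expanding that
  direction over \<open>Basis\<close> gives products of functions of the same shape with fixed
  directions, so the induction hypothesis for all \<open>m\<close> and \<open>vs\<close> applies and
  integration gains one order.\<close>

lemma taylor_along_solution:
  fixes D :: "nat \<Rightarrow> 'a::euclidean_space \<Rightarrow> 'a list \<Rightarrow> 'a" and z :: "real \<Rightarrow> 'a"
  assumes cont: "\<And>m vs. length vs = m \<Longrightarrow> continuous_on UNIV (\<lambda>x. D m x vs)"
    and deriv: "\<And>m vs x. length vs = m \<Longrightarrow> ((\<lambda>z. D m z vs) has_derivative (\<lambda>v. D (Suc m) x (v # vs))) (at x)"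
    and z: "\<forall>\<^sub>F x in nhds 0. (z has_vector_derivative D 0 (z x) []) (at x)"
    and "length vs = m"
  shows "taylor n (\<lambda>x. D m (z x) vs)"
  using \<open>length vs = m\<close>
proof (induction n arbitrary: m vs)
  case 0
  have "(z has_vector_derivative D 0 (z 0) []) (at 0)"
    using z by (rule eventually_nhds_x_imp_x)
  then have "isCont z 0"
    by (rule has_vector_derivative_continuous)
  moreover have "isCont (\<lambda>x. D m x vs) (z 0)"
    using cont[OF 0] by (simp add: continuous_on_eq_continuous_at)
  ultimately have "isCont (\<lambda>x. D m (z x) vs) 0"
    by (rule isCont_o2)
  then have "((\<lambda>x. D m (z x) vs) \<longlongrightarrow> D m (z 0) vs) (nhds 0)"
    using tendsto_at_iff_tendsto_nhds[of "\<lambda>x. D m (z x) vs" 0] by (simp add: isCont_def)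
  then show ?case
    by (intro taylor_remainder order_ge_tendsto)
next
  case (Suc n)
  have "\<forall>\<^sub>F x in nhds 0. ((\<lambda>x. D m (z x) vs) has_vector_derivative
      (\<Sum>b\<in>Basis. (D 0 (z x) [] \<bullet> b) *\<^sub>R D (Suc m) (z x) (b # vs))) (at x)"
    using z
  proof eventually_elim
    case (elim x)
    let ?L = "\<lambda>v. D (Suc m) (z x) (v # vs)"
    have L: "((\<lambda>z. D m z vs) has_derivative ?L) (at (z x))"
      using deriv[OF Suc.prems] .
    interpret L: linear ?L
      using has_derivative_linear[OF L] .
    let ?v = "D 0 (z x) []"
    have "?L ?v = (\<Sum>b\<in>Basis. (?v \<bullet> b) *\<^sub>R ?L b)"
      by (rule linear_eq_sum_Basis[OF L.linear_axioms])
    moreover have "((\<lambda>x. D m (z x) vs) has_vector_derivative ?L ?v) (at x)"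
      using has_derivative_compose[OF elim[unfolded has_vector_derivative_def] L]
      by (simp add: has_vector_derivative_def L.scaleR)
    ultimately show ?case by (simp only:)
  qed
  moreover have "taylor n (\<lambda>x. \<Sum>b\<in>Basis. (D 0 (z x) [] \<bullet> b) *\<^sub>R D (Suc m) (z x) (b # vs))"
    using Suc by (intro taylor_sum taylor_scaleR taylor_bounded_linear[OF bounded_linear_inner_left] Suc.IH) auto
  ultimately show ?case
    by (intro taylor_integrate)
qed

section \<open>Lipschitz and quadratic bounds on balls\<close>

lemma onorm_le_sum_Basis:
  fixes L :: "'a::euclidean_space \<Rightarrow> 'b::real_normed_vector"
  assumes "linear L" "\<And>b. b \<in> Basis \<Longrightarrow> norm (L b) \<le> B b"
  shows "onorm L \<le> (\<Sum>b\<in>Basis. B b)"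
proof (rule onorm_le)
  fix v
  have "L v = (\<Sum>b\<in>Basis. (v \<bullet> b) *\<^sub>R L b)"
    by (rule linear_eq_sum_Basis[OF assms(1)])
  also have "norm \<dots> \<le> (\<Sum>b\<in>Basis. norm v * B b)"
    using assms(2) by (intro sum_norm_le) (auto simp: Basis_le_norm intro!: mult_mono)
  finally show "norm (L v) \<le> (\<Sum>b\<in>Basis. B b) * norm v"
    by (simp add: sum_distrib_left mult.commute)
qed

text \<open>\<open>smooth\<close> gives continuity only for each fixed direction. Compactness bounds
  the derivative on every basis vector, the sum of these bounds controls the operator norm, and the
  mean value inequality on the convex ball concludes.\<close>

lemma lipschitz_on_cball_of_continuous_derivative:
  fixes g :: "'a::euclidean_space \<Rightarrow> 'b::real_normed_vector"
  assumes deriv: "\<And>x. (g has_derivative g' x) (at x)"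
    and cont: "\<And>b. b \<in> Basis \<Longrightarrow> continuous_on UNIV (\<lambda>x. g' x b)"
  obtains L where "L \<ge> 0" "\<And>u v. u \<in> cball p r \<Longrightarrow> v \<in> cball p r \<Longrightarrow> norm (g u - g v) \<le> L * norm (u - v)"
proof -
  have "\<exists>B. \<forall>x\<in>cball p r. norm (g' x b) \<le> B" if "b \<in> Basis" for b
  proof -
    have "compact ((\<lambda>x. g' x b) ` cball p r)"
      using continuous_on_subset[OF cont[OF that] subset_UNIV, of "cball p r"]
      by (intro compact_continuous_image compact_cball)
    then have "bounded ((\<lambda>x. g' x b) ` cball p r)"
      by (rule compact_imp_bounded)
    then show ?thesis
      by (auto simp: bounded_iff)
  qed
  then obtain B where B: "\<And>b x. b \<in> Basis \<Longrightarrow> x \<in> cball p r \<Longrightarrow> norm (g' x b) \<le> B b"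
    by metis
  let ?L = "\<Sum>b\<in>Basis. B b"
  have *: "norm (g u - g v) \<le> ?L * norm (u - v)" if "u \<in> cball p r" "v \<in> cball p r" for u v
    using that
  proof (intro differentiable_bound[of "cball p r" g g'])
    fix x assume "x \<in> cball p r"
    then show "onorm (g' x) \<le> ?L"
      using B deriv by (intro onorm_le_sum_Basis) (auto intro: has_derivative_linear)
  qed (auto intro: has_derivative_at_withinI[OF deriv])
  show ?thesis
  proof (rule that[of "\<bar>?L\<bar>"])
    fix u v assume "u \<in> cball p r" "v \<in> cball p r"
    then show "norm (g u - g v) \<le> \<bar>?L\<bar> * norm (u - v)"
      using * by (meson abs_ge_self mult_right_mono norm_ge_zero order.trans)
  qed simp
qed

text \<open>On the segment from \<open>v\<close> to \<open>u\<close> the derivative differs from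
  \<open>g' v\<close> by at most a constant times \<open>norm (u - v)\<close>; the linearised mean
  value inequality contributes the second factor.\<close>

lemma quadratic_remainder_of_lipschitz_derivative:
  fixes g :: "'a::euclidean_space \<Rightarrow> 'b::real_normed_vector"
  assumes deriv: "\<And>x. (g has_derivative g' x) (at x)"
    and lip: "\<And>b u v. b \<in> Basis \<Longrightarrow> u \<in> cball p r \<Longrightarrow> v \<in> cball p r \<Longrightarrow> norm (g' u b - g' v b) \<le> L b * norm (u - v)"
    and L: "\<And>b. b \<in> Basis \<Longrightarrow> L b \<ge> 0"
    and uv: "u \<in> cball p r" "v \<in> cball p r"
  shows "norm (g u - g v - g' v (u - v)) \<le> (\<Sum>b\<in>Basis. L b) * (norm (u - v))\<^sup>2"
proof -
  have seg: "closed_segment v u \<subseteq> cball p r"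
    using uv by (simp add: closed_segment_subset)
  have "norm (g u - g v - g' v (u - v)) \<le> norm (u - v) * (\<Sum>b\<in>Basis. L b * norm (u - v))"
  proof (rule differentiable_bound_linearization[where S = "closed_segment v u" and f' = g' and ?x0.0 = v])
    show "v + t *\<^sub>R (u - v) \<in> closed_segment v u" if "t \<in> {0..1}" for t
    proof -
      have "v + t *\<^sub>R (u - v) = (1 - t) *\<^sub>R v + t *\<^sub>R u"
        by (simp add: algebra_simps)
      then show ?thesis
        using that unfolding in_segment by (intro exI[of _ t]) simp
    qed
    fix x assume x: "x \<in> closed_segment v u"
    show "(g has_derivative g' x) (at x within closed_segment v u)"
      by (rule has_derivative_at_withinI[OF deriv])
    show "onorm (g' x - g' v) \<le> (\<Sum>b\<in>Basis. L b * norm (u - v))"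
    proof (rule onorm_le_sum_Basis)
      show "linear (g' x - g' v)"
        using linear_compose_sub[OF has_derivative_linear[OF deriv] has_derivative_linear[OF deriv]]
        by (simp add: fun_diff_def)
      fix b :: 'a assume "b \<in> Basis"
      then have "norm (g' x b - g' v b) \<le> L b * norm (x - v)"
        using lip x seg uv by blast
      also have "\<dots> \<le> L b * norm (u - v)"
        using L[OF \<open>b \<in> Basis\<close>] segment_bound1[OF x] by (intro mult_left_mono) auto
      finally show "norm ((g' x - g' v) b) \<le> L b * norm (u - v)"
        by simp
    qed
  qed simp
  then show ?thesis
    by (simp add: power2_eq_square sum_distrib_left sum_distrib_right mult_ac)
qed

section \<open>Order of Runge--Kutta methods under simplifying assumptions\<close>

lemma order_ge_norm: "order_ge F n u \<Longrightarrow> order_ge F n (\<lambda>h. norm (u h))"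
  by (simp add: order_ge_def)

lemma order_ge_isCont: "isCont u 0 \<Longrightarrow> order_ge (at 0) 0 u"
  by (auto simp: isCont_def intro: order_ge_tendsto)

text \<open>Covers the stages (\<open>b\<close> a row of the matrix,
  \<open>\<theta> = tau i\<close>) and the final step (\<open>b = w\<close>,
  \<open>\<theta> = 1\<close>) at once. Each coefficient is the error of the quadrature on t^m over
  the interval from 0 to \<open>\<theta>\<close>.\<close>

lemma quadrature_defect:
  fixes z g :: "real \<Rightarrow> 'a::real_normed_vector" and b tau :: "nat \<Rightarrow> real"
  assumes g: "order_ge (nhds 0) n (\<lambda>x. g x - (\<Sum>m<n. x ^ m *\<^sub>R c m))"
    and z: "order_ge (nhds 0) (Suc n) (\<lambda>x. z x - z0 - (\<Sum>m<n. (x ^ Suc m / Suc m) *\<^sub>R c m))"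
  shows "order_ge (at 0) (Suc n) (\<lambda>h. z0 + h *\<^sub>R (\<Sum>l\<in>A. b l *\<^sub>R g (h * tau l)) - z (h * \<theta>)
    - (\<Sum>m<n. (h ^ Suc m * ((\<Sum>l\<in>A. b l * tau l ^ m) - \<theta> ^ Suc m / Suc m)) *\<^sub>R c m))"
proof -
  let ?r = "\<lambda>x. g x - (\<Sum>m<n. x ^ m *\<^sub>R c m)"
  let ?q = "\<lambda>x. z x - z0 - (\<Sum>m<n. (x ^ Suc m / Suc m) *\<^sub>R c m)"
  have *: "order_ge (nhds 0) n (\<lambda>h. \<Sum>l\<in>A. b l *\<^sub>R ?r (h * tau l))"
    by (intro order_ge_sum order_ge_scaleR_const order_ge_compose_mult[OF g])
  have main: "order_ge (nhds 0) (Suc n) (\<lambda>h. h *\<^sub>R (\<Sum>l\<in>A. b l *\<^sub>R ?r (h * tau l)) - ?q (h * \<theta>))"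
    using order_ge_scaleR[OF order_ge_power[of _ 1] *]
    by (intro order_ge_diff order_ge_compose_mult[OF z]) simp
  have eq: "h *\<^sub>R (\<Sum>l\<in>A. b l *\<^sub>R ?r (h * tau l)) - ?q (h * \<theta>) =
      z0 + h *\<^sub>R (\<Sum>l\<in>A. b l *\<^sub>R g (h * tau l)) - z (h * \<theta>)
      - (\<Sum>m<n. (h ^ Suc m * ((\<Sum>l\<in>A. b l * tau l ^ m) - \<theta> ^ Suc m / Suc m)) *\<^sub>R c m)" for h
  proof -
    have "h *\<^sub>R (\<Sum>l\<in>A. b l *\<^sub>R (\<Sum>m<n. (h * tau l) ^ m *\<^sub>R c m)) =
        (\<Sum>m<n. (h ^ Suc m * (\<Sum>l\<in>A. b l * tau l ^ m)) *\<^sub>R c m)"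
      unfolding scaleR_sum_right sum_distrib_left scaleR_sum_left
      by (subst sum.swap) (simp add: power_mult_distrib mult_ac)
    then show ?thesis
      by (simp add: right_diff_distrib scaleR_diff_right scaleR_diff_left sum_subtractf power_mult_distrib
          del: power_Suc of_nat_Suc)
  qed
  show ?thesis
    using order_ge_filter_mono[OF main at_0_le_nhds_0] unfolding eq .
qed

text \<open>The contraction that makes the stage equations well-posed: the factor \<open>h\<close> absorbs the
  unknown error on the right-hand side.\<close>
lemma order_ge_implicit:
  fixes e :: "'i \<Rightarrow> real \<Rightarrow> 'b::real_normed_vector" and d :: "'i \<Rightarrow> real \<Rightarrow> 'c::real_normed_vector"
  assumes "finite I" "K \<ge> 0" and d: "\<And>i. i \<in> I \<Longrightarrow> order_ge (at 0) n (d i)"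
    and le: "\<forall>\<^sub>F h in at 0. \<forall>i\<in>I. norm (e i h) \<le> norm (d i h) + \<bar>h\<bar> * (K * (\<Sum>l\<in>I. norm (e l h)))"
    and "i \<in> I"
  shows "order_ge (at 0) n (e i)"
proof -
  \<comment> \<open>Summing the estimate over \<open>I\<close> multiplies the coupling by
    \<open>card I\<close>. Once \<open>\<bar>h\<bar> * ?c < 1 / 2\<close>, at most half of the sum
    returns on the right and is absorbed, whence the factor 2.\<close>
  let ?c = "real (card I) * K"
  have "((\<lambda>h. \<bar>h\<bar> * ?c) \<longlongrightarrow> \<bar>0\<bar> * ?c) (at 0)"
    by (intro tendsto_intros)
  then have "\<forall>\<^sub>F h in at 0. \<bar>h\<bar> * ?c < 1 / 2"
    by (intro order_tendstoD) auto
  with le have *: "\<forall>\<^sub>F h in at 0. norm (e i h) \<le> 2 * norm (\<Sum>i\<in>I. norm (d i h))"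
  proof eventually_elim
    case (elim h)
    let ?S = "\<Sum>l\<in>I. norm (e l h)"
    have S: "?S \<ge> 0"
      by (intro sum_nonneg) auto
    have "?S \<le> (\<Sum>i\<in>I. norm (d i h) + \<bar>h\<bar> * (K * ?S))"
      using elim(1) by (intro sum_mono) auto
    also have "\<dots> = (\<Sum>i\<in>I. norm (d i h)) + (\<bar>h\<bar> * ?c) * ?S"
      by (simp add: sum.distrib)
    also have "(\<bar>h\<bar> * ?c) * ?S \<le> 1 / 2 * ?S"
      using elim(2) S by (intro mult_right_mono) auto
    finally have "?S \<le> 2 * (\<Sum>i\<in>I. norm (d i h))"
      by simp
    moreover have "norm (e i h) \<le> ?S"
      using \<open>i \<in> I\<close> \<open>finite I\<close> by (intro member_le_sum) auto
    ultimately show ?case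
      by (simp add: sum_nonneg)
  qed
  have "order_ge (at 0) n (\<lambda>h. \<Sum>i\<in>I. norm (d i h))"
    using d by (intro order_ge_sum order_ge_norm)
  from order_ge_bound[OF this *] show ?thesis
    by simp
qed

text \<open>Butcher's conditions \<open>B(2s)\<close>, \<open>C(s)\<close> and \<open>D(s - 1)\<close>.\<close>
locale simplifying_assumptions =
  fixes k s :: nat and tau w :: "nat \<Rightarrow> real" and a :: "nat \<Rightarrow> nat \<Rightarrow> real"
  assumes quadrature: "m < 2 * s \<Longrightarrow> (\<Sum>i=1..k. w i * tau i ^ m) = 1 / Suc m"
    and stage_order: "i \<in> {1..k} \<Longrightarrow> m < s \<Longrightarrow> (\<Sum>l=1..k. a i l * tau l ^ m) = tau i ^ Suc m / Suc m"
    and adjoint_order: "l \<in> {1..k} \<Longrightarrow> Suc m < s \<Longrightarrow>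
      (\<Sum>i=1..k. w i * tau i ^ m * a i l) = w l * (1 - tau l ^ Suc m) / Suc m"
begin

text \<open>The multiplier of the solution's coefficient \<open>c m\<close> in the term of order
  \<open>m + 1\<close> of the defect of stage \<open>i\<close>; it measures the failure of the stage
  quadrature on t^m.\<close>

definition stage_defect :: "nat \<Rightarrow> nat \<Rightarrow> real" where
  "stage_defect i m = (\<Sum>l=1..k. a i l * tau l ^ m) - tau i ^ Suc m / Suc m"

lemma stage_defect_zero: "i \<in> {1..k} \<Longrightarrow> m < s \<Longrightarrow> stage_defect i m = 0"
  by (simp only: stage_defect_def stage_order diff_self)

text \<open>For \<open>Suc m < s\<close>, \<open>D(s - 1)\<close> replaces the row times the matrix
  by weights, and \<open>B(2s)\<close> evaluates both remaining sums. Otherwise the hypothesis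
  forces \<open>p < s\<close>, and \<open>C(s)\<close> makes every defect zero.\<close>

lemma stage_defect_orthogonal:
  assumes "m + p + 1 < 2 * s"
  shows "(\<Sum>i=1..k. w i * tau i ^ m * stage_defect i p) = 0"
proof (cases "Suc m < s")
  case True
  have "(\<Sum>i=1..k. w i * tau i ^ m * stage_defect i p) =
      (\<Sum>i=1..k. \<Sum>l=1..k. w i * tau i ^ m * a i l * tau l ^ p) - (\<Sum>i=1..k. w i * tau i ^ (m + p + 1)) / Suc p"
    by (simp add: stage_defect_def right_diff_distrib sum_subtractf sum_distrib_left sum_divide_distrib
        power_add mult_ac)
  also have "(\<Sum>i=1..k. \<Sum>l=1..k. w i * tau i ^ m * a i l * tau l ^ p) =
      (\<Sum>l=1..k. (\<Sum>i=1..k. w i * tau i ^ m * a i l) * tau l ^ p)"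
    by (subst sum.swap) (simp add: sum_distrib_right)
  also have "\<dots> = (\<Sum>l=1..k. (w l * tau l ^ p - w l * tau l ^ (m + p + 1)) / Suc m)"
  proof (intro sum.cong refl)
    fix l assume "l \<in> {1..k}"
    then show "(\<Sum>i=1..k. w i * tau i ^ m * a i l) * tau l ^ p =
        (w l * tau l ^ p - w l * tau l ^ (m + p + 1)) / Suc m"
      by (subst adjoint_order[OF _ True]) (simp_all add: power_add algebra_simps)
  qed
  also have "\<dots> = ((\<Sum>l=1..k. w l * tau l ^ p) - (\<Sum>l=1..k. w l * tau l ^ (m + p + 1))) / Suc m"
    unfolding sum_subtractf[symmetric] by (rule sum_divide_distrib[symmetric])
  also have "(\<Sum>l=1..k. w l * tau l ^ p) = 1 / Suc p"
    using assms by (intro quadrature) simp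
  also have "(\<Sum>l=1..k. w l * tau l ^ (m + p + 1)) = 1 / Suc (m + p + 1)"
    using assms by (intro quadrature)
  also have "(1 / real (Suc p) - 1 / real (Suc (m + p + 1))) / real (Suc m)
      - 1 / real (Suc (m + p + 1)) / real (Suc p) = 0"
    by (simp add: divide_simps)
  finally show ?thesis .
next
  case False
  then show ?thesis
    using assms by (intro sum.neutral ballI) (simp add: stage_defect_zero)
qed

text \<open>Rows of the form \<open>w i * \<Sum>\<^sub>m \<alpha>\<^sub>m(h) (h tau i)^m + O(h^s)\<close> with bounded \<open>\<alpha>\<^sub>m\<close>.\<close>
inductive graded_row :: "(nat \<Rightarrow> real \<Rightarrow> real) \<Rightarrow> bool" where
  error: "(\<And>i. i \<in> {1..k} \<Longrightarrow> order_ge (at 0) s (v i)) \<Longrightarrow> graded_row v"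
| monomial: "order_ge (at 0) 0 \<alpha> \<Longrightarrow> graded_row (\<lambda>i h. \<alpha> h * (w i * (h * tau i) ^ m))"
| add: "graded_row u \<Longrightarrow> graded_row v \<Longrightarrow> graded_row (\<lambda>i h. u i h + v i h)"

text \<open>Rows are unconstrained outside \<open>{1..k}\<close>, so the difference of
  \<open>u\<close> and \<open>v\<close> counts as an \<open>error\<close> row.\<close>

lemma graded_row_cong:
  assumes "graded_row u" "\<And>i h. i \<in> {1..k} \<Longrightarrow> u i h = v i h"
  shows "graded_row v"
proof -
  have "graded_row (\<lambda>i h. v i h - u i h)"
    using assms(2) by (intro graded_row.error) simp
  from graded_row.add[OF assms(1) this] show ?thesis
    by simp
qed

lemma graded_row_sum:
  "(\<And>j. j \<in> A \<Longrightarrow> graded_row (v j)) \<Longrightarrow> graded_row (\<lambda>i h. \<Sum>j\<in>A. v j i h)"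
  by (induction A rule: infinite_finite_induct) (auto intro: graded_row.add graded_row.error)

lemma graded_row_bounded:
  assumes "graded_row v" "i \<in> {1..k}"
  shows "order_ge (at 0) 0 (v i)"
  using assms
proof induction
  case (error v)
  then show ?case
    by (auto intro: order_ge_mono at_0_le_nhds_0)
next
  case (monomial \<alpha> m)
  have "order_ge (at 0) 0 (\<lambda>h. w i * (h * tau i) ^ m)"
    by (intro order_ge_isCont continuous_intros)
  from order_ge_mult[OF monomial(1) this] show ?case
    by simp
next
  case (add u v)
  then show ?case
    by (auto intro: order_ge_add)
qed

text \<open>\<open>D(s - 1)\<close> sends a monomial row of degree \<open>m\<close> to one of degree
  0 and one of degree \<open>m + 1\<close>. The extra \<open>h\<close> supplies the power needed to
  pair with \<open>tau l ^ Suc m\<close>. When \<open>D(s - 1)\<close> no longer applies,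
  \<open>h ^ Suc m\<close> already makes the row an error.\<close>

lemma graded_row_matrix:
  assumes "graded_row v"
  shows "graded_row (\<lambda>l h. h * (\<Sum>i=1..k. v i h * a i l))"
  using assms
proof induction
  case (error v)
  show ?case
  proof (rule graded_row.error)
    fix l
    have "order_ge (at 0) s (\<lambda>h. \<Sum>i=1..k. v i h * a i l)"
      using order_ge_mult[OF error order_ge_const] by (intro order_ge_sum) simp
    from order_ge_mult[OF order_ge_power[of _ 1] this]
    show "order_ge (at 0) s (\<lambda>h. h * (\<Sum>i=1..k. v i h * a i l))"
      by (auto intro: order_ge_mono at_0_le_nhds_0)
  qed
next
  case (monomial \<alpha> m)
  have eq: "h * (\<Sum>i=1..k. \<alpha> h * (w i * (h * tau i) ^ m) * a i l) =
      \<alpha> h * (h ^ Suc m * (\<Sum>i=1..k. w i * tau i ^ m * a i l))" for l h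
    by (simp add: sum_distrib_left power_mult_distrib mult_ac)
  show ?case
  proof (cases "Suc m < s")
    case True
    have c: "order_ge (at 0) 0 (\<lambda>h. h ^ Suc m / Suc m)" "order_ge (at 0) 0 (\<lambda>h::real. - 1 / real (Suc m))"
      by (intro order_ge_isCont continuous_intros, simp)+
    have "order_ge (at 0) 0 (\<lambda>h. \<alpha> h * (h ^ Suc m / Suc m))"
        "order_ge (at 0) 0 (\<lambda>h. \<alpha> h * (- 1 / real (Suc m)))"
      using order_ge_mult[OF monomial c(1)] order_ge_mult[OF monomial c(2)] by (simp_all only: add_0)
    then have "graded_row (\<lambda>l h. \<alpha> h * (h ^ Suc m / Suc m) * (w l * (h * tau l) ^ 0)
        + \<alpha> h * (- 1 / Suc m) * (w l * (h * tau l) ^ Suc m))"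
      by (intro graded_row.add graded_row.monomial)
    then show ?thesis
    proof (rule graded_row_cong)
      fix l h assume "l \<in> {1..k}"
      then have "(\<Sum>i=1..k. w i * tau i ^ m * a i l) = w l * (1 - tau l ^ Suc m) / Suc m"
        using True by (rule adjoint_order)
      then show "\<alpha> h * (h ^ Suc m / Suc m) * (w l * (h * tau l) ^ 0)
          + \<alpha> h * (- 1 / Suc m) * (w l * (h * tau l) ^ Suc m) =
          h * (\<Sum>i=1..k. \<alpha> h * (w i * (h * tau i) ^ m) * a i l)"
        unfolding eq
        by (simp add: power_mult_distrib right_diff_distrib diff_divide_distrib mult_ac
            del: power_Suc of_nat_Suc)
    qed
  next
    case False
    have le: "order_ge (at 0) (Suc m) (\<lambda>h. \<alpha> h * (h ^ Suc m * c))" for c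
      using order_ge_mult[OF monomial order_ge_mult[OF order_ge_power[of _ "Suc m"] order_ge_const]] by simp
    show ?thesis
      unfolding eq using False
      by (intro graded_row.error order_ge_mono[OF le _ at_0_le_nhds_0]) simp
  qed
next
  case (add u v)
  from graded_row.add[OF add.IH] show ?case
    by (simp add: distrib_right distrib_left sum.distrib)
qed

text \<open>Powers of \<open>h * tau i\<close> in the expansion of \<open>M\<close> combine with the
  monomial, and the remainder of order \<open>s\<close> is an error row. No bound is imposed on
  monomial degrees, so truncation is never an issue.\<close>

lemma graded_row_times_taylor:
  assumes "graded_row v" and M: "taylor s M"
  shows "graded_row (\<lambda>i h. v i h * M (h * tau i))"
  using assms(1)
proof induction
  case (error v)
  have M0: "order_ge (at 0) 0 (\<lambda>h. M (h * t))" for t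
    using order_ge_filter_mono[OF order_ge_compose_mult[OF taylor_bounded[OF M]] at_0_le_nhds_0] .
  show ?case
    using order_ge_mult[OF error M0] by (intro graded_row.error) simp
next
  case (monomial \<alpha> m)
  obtain c where c: "order_ge (nhds 0) s (\<lambda>x. M x - (\<Sum>p<s. x ^ p *\<^sub>R c p))"
    using M by (auto simp: taylor_def)
  let ?r = "\<lambda>x. M x - (\<Sum>p<s. x ^ p * c p)"
  have "graded_row (\<lambda>i h. (\<Sum>p<s. (\<alpha> h * c p) * (w i * (h * tau i) ^ (m + p))))"
    using order_ge_mult[OF monomial order_ge_const]
    by (intro graded_row_sum graded_row.monomial) simp
  moreover have "graded_row (\<lambda>i h. \<alpha> h * (w i * (h * tau i) ^ m) * ?r (h * tau i))"
  proof (rule graded_row.error)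
    fix i assume "i \<in> {1..k}"
    have r: "order_ge (at 0) s (\<lambda>h. ?r (h * tau i))"
      using order_ge_filter_mono[OF order_ge_compose_mult[OF c] at_0_le_nhds_0] by simp
    have "order_ge (at 0) 0 (\<lambda>h. \<alpha> h * (w i * (h * tau i) ^ m))"
      using graded_row_bounded[OF graded_row.monomial[OF monomial] \<open>i \<in> {1..k}\<close>] .
    from order_ge_mult[OF this r]
    show "order_ge (at 0) s (\<lambda>h. \<alpha> h * (w i * (h * tau i) ^ m) * ?r (h * tau i))"
      by simp
  qed
  ultimately have "graded_row (\<lambda>i h. (\<Sum>p<s. (\<alpha> h * c p) * (w i * (h * tau i) ^ (m + p))) +
      \<alpha> h * (w i * (h * tau i) ^ m) * ?r (h * tau i))"
    by (rule graded_row.add)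
  then show ?case
  proof (rule graded_row_cong)
    fix i h
    have "(\<Sum>p<s. (\<alpha> h * c p) * (w i * (h * tau i) ^ (m + p))) =
        \<alpha> h * (w i * (h * tau i) ^ m) * (\<Sum>p<s. (h * tau i) ^ p * c p)"
      by (simp add: sum_distrib_left power_add mult_ac)
    then show "(\<Sum>p<s. (\<alpha> h * c p) * (w i * (h * tau i) ^ (m + p))) +
        \<alpha> h * (w i * (h * tau i) ^ m) * ?r (h * tau i) = \<alpha> h * (w i * (h * tau i) ^ m) * M (h * tau i)"
      by (simp only: right_diff_distrib)
  qed
next
  case (add u v)
  from graded_row.add[OF add.IH] show ?case
    by (simp add: distrib_right)
qed

text \<open>An error row contributes order s + (s + 1). Against a monomial row of degree
  \<open>m\<close>, defect terms with \<open>m + p + 1 < 2 * s\<close> cancel by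
  \<open>stage_defect_orthogonal\<close>, and the others carry enough powers of
  \<open>h\<close>.\<close>

lemma graded_row_defect:
  fixes c :: "nat \<Rightarrow> 'b::real_normed_vector"
  assumes "graded_row v"
    and d: "\<And>i. i \<in> {1..k} \<Longrightarrow>
      order_ge (at 0) (Suc (2 * s)) (\<lambda>h. d i h - (\<Sum>p<2 * s. (h ^ Suc p * stage_defect i p) *\<^sub>R c p))"
    and d_order: "\<And>i. i \<in> {1..k} \<Longrightarrow> order_ge (at 0) (Suc s) (d i)"
  shows "order_ge (at 0) (2 * s) (\<lambda>h. \<Sum>i=1..k. v i h *\<^sub>R d i h)"
  using assms(1)
proof induction
  case (error v)
  have "order_ge (at 0) (2 * s) (\<lambda>h. v i h *\<^sub>R d i h)" if "i \<in> {1..k}" for i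
    by (rule order_ge_mono[OF order_ge_scaleR[OF error[OF that] d_order[OF that]] _ at_0_le_nhds_0]) simp
  then show ?case
    by (intro order_ge_sum)
next
  case (monomial \<alpha> m)
  let ?d = "\<lambda>i h. \<Sum>p<2 * s. (h ^ Suc p * stage_defect i p) *\<^sub>R c p"
  have 1: "order_ge (at 0) (2 * s) (\<lambda>h. \<Sum>i=1..k. (w i * (h * tau i) ^ m) *\<^sub>R (d i h - ?d i h))"
  proof (intro order_ge_sum)
    fix i assume i: "i \<in> {1..k}"
    have "order_ge (at 0) 0 (\<lambda>h. w i * (h * tau i) ^ m)"
      by (intro order_ge_isCont continuous_intros)
    from order_ge_scaleR[OF this d[OF i]]
    show "order_ge (at 0) (2 * s) (\<lambda>h. (w i * (h * tau i) ^ m) *\<^sub>R (d i h - ?d i h))"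
      by (auto intro: order_ge_mono at_0_le_nhds_0)
  qed
  have 2: "order_ge (at 0) (2 * s) (\<lambda>h. \<Sum>i=1..k. (w i * (h * tau i) ^ m) *\<^sub>R ?d i h)"
  proof -
    have "order_ge (at 0) (2 * s) (\<lambda>h. \<Sum>p<2 * s.
        (h ^ (m + p + 1) * (\<Sum>i=1..k. w i * tau i ^ m * stage_defect i p)) *\<^sub>R c p)"
    proof (intro order_ge_sum)
      fix p
      show "order_ge (at 0) (2 * s)
          (\<lambda>h. (h ^ (m + p + 1) * (\<Sum>i=1..k. w i * tau i ^ m * stage_defect i p)) *\<^sub>R c p)"
      proof (cases "m + p + 1 < 2 * s")
        case True
        then show ?thesis
          by (simp only: stage_defect_orthogonal) simp
      next
        case False
        then show ?thesis
          by (intro order_ge_mono[OF order_ge_power_scaleR _ at_0_le_nhds_0]) simp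
      qed
    qed
    moreover have "(\<Sum>i=1..k. (w i * (h * tau i) ^ m) *\<^sub>R ?d i h) = (\<Sum>p<2 * s.
        (h ^ (m + p + 1) * (\<Sum>i=1..k. w i * tau i ^ m * stage_defect i p)) *\<^sub>R c p)" for h
      unfolding scaleR_sum_right sum_distrib_left scaleR_sum_left
      by (subst sum.swap) (simp add: power_mult_distrib power_add mult_ac)
    ultimately show ?thesis
      by simp
  qed
  have "order_ge (at 0) (2 * s) (\<lambda>h. \<Sum>i=1..k. (w i * (h * tau i) ^ m) *\<^sub>R d i h)"
    by (rule order_ge_cong[OF order_ge_add[OF 1 2]])
      (simp only: sum.distrib[symmetric] scaleR_add_right[symmetric] diff_add_cancel eventually_True simp_thms)
  from order_ge_scaleR[OF monomial this] show ?case
    by (simp add: scaleR_sum_right)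
next
  case (add u v)
  from order_ge_add[OF add.IH] show ?case
    by (simp add: scaleR_add_left sum.distrib)
qed

text \<open>Substituting the error recursion into the pairing raises the order of the row by one and
  keeps it graded; once the row is \<open>O(h^s)\<close> the bound \<open>e = O(h^(s + 1))\<close> suffices.\<close>
lemma graded_row_error:
  fixes e d :: "'b \<Rightarrow> nat \<Rightarrow> real \<Rightarrow> real" and M :: "'b \<Rightarrow> 'b \<Rightarrow> real \<Rightarrow> real"
  assumes e: "\<And>b i. b \<in> B \<Longrightarrow> i \<in> {1..k} \<Longrightarrow> order_ge (at 0) (Suc s) (e b i)"
    and d: "\<And>b v. b \<in> B \<Longrightarrow> graded_row v \<Longrightarrow> order_ge (at 0) (2 * s) (\<lambda>h. \<Sum>i=1..k. v i h * d b i h)"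
    and M: "\<And>b b'. b \<in> B \<Longrightarrow> b' \<in> B \<Longrightarrow> taylor s (M b b')"
    and recursion: "\<And>b i. b \<in> B \<Longrightarrow> i \<in> {1..k} \<Longrightarrow> order_ge (at 0) (2 * s)
      (\<lambda>h. e b i h - d b i h - h * (\<Sum>l=1..k. a i l * (\<Sum>b'\<in>B. M b b' (h * tau l) * e b' l h)))"
    and "n \<le> s" and "\<And>b. b \<in> B \<Longrightarrow> graded_row (v b)"
    and "\<And>b i. b \<in> B \<Longrightarrow> i \<in> {1..k} \<Longrightarrow> order_ge (at 0) n (v b i)"
  shows "order_ge (at 0) (2 * s) (\<lambda>h. \<Sum>b\<in>B. \<Sum>i=1..k. v b i h * e b i h)"
  using assms(5-7)
\<comment> \<open>\<open>inc_induct\<close> descends from \<open>s\<close>: the claim for rows of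
  order \<open>Suc n\<close> yields it for order \<open>n\<close>.\<close>
proof (induction n arbitrary: v rule: inc_induct)
  case base
  have "order_ge (at 0) (2 * s) (\<lambda>h. v b i h * e b i h)" if "b \<in> B" "i \<in> {1..k}" for b i
    using order_ge_mult[OF base(2)[OF that] e[OF that]] by (auto intro: order_ge_mono at_0_le_nhds_0)
  then show ?case
    by (intro order_ge_sum)
next
  case (step n)
  let ?X = "\<lambda>b i h. h * (\<Sum>l=1..k. a i l * (\<Sum>b'\<in>B. M b b' (h * tau l) * e b' l h))"
  \<comment> \<open>The row \<open>v\<close> multiplied from the right by \<open>h\<close>, the
    matrix and the Jacobian entries. Pairing \<open>v\<close> with the coupling term
    \<open>?X\<close> equals pairing \<open>u\<close> with \<open>e\<close>.\<close>
  define u where "u b' l h = (\<Sum>b\<in>B. (h * (\<Sum>i=1..k. v b i h * a i l)) * M b b' (h * tau l))" for b' l h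
  have "graded_row (u b')" if "b' \<in> B" for b'
    unfolding u_def using that M step.prems(1)
    by (intro graded_row_sum graded_row_times_taylor graded_row_matrix)
  moreover have "order_ge (at 0) (Suc n) (u b' l)" if "b' \<in> B" for b' l
    unfolding u_def
  proof (intro order_ge_sum)
    fix b assume b: "b \<in> B"
    have 1: "order_ge (at 0) n (\<lambda>h. \<Sum>i=1..k. v b i h * a i l)"
      using order_ge_mult[OF step.prems(2)[OF b] order_ge_const] by (intro order_ge_sum) simp
    have 2: "order_ge (at 0) 0 (\<lambda>h. M b b' (h * tau l))"
      using order_ge_filter_mono[OF order_ge_compose_mult[OF taylor_bounded[OF M[OF b that]]] at_0_le_nhds_0] .
    show "order_ge (at 0) (Suc n) (\<lambda>h. h * (\<Sum>i=1..k. v b i h * a i l) * M b b' (h * tau l))"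
      using order_ge_mult[OF order_ge_mult[OF order_ge_power[of _ 1] 1] 2] by simp
  qed
  ultimately have "order_ge (at 0) (2 * s) (\<lambda>h. \<Sum>b\<in>B. \<Sum>i=1..k. u b i h * e b i h)"
    by (intro step.IH)
  moreover have "(\<Sum>b\<in>B. \<Sum>i=1..k. v b i h * ?X b i h) = (\<Sum>b'\<in>B. \<Sum>l=1..k. u b' l h * e b' l h)" for h
  proof -
    have "(\<Sum>b\<in>B. \<Sum>i=1..k. v b i h * ?X b i h) =
        (\<Sum>b\<in>B. \<Sum>i=1..k. \<Sum>l=1..k. \<Sum>b'\<in>B. v b i h * h * a i l * M b b' (h * tau l) * e b' l h)"
      by (simp add: sum_distrib_left mult_ac)
    also have "\<dots> = (\<Sum>b\<in>B. \<Sum>l=1..k. \<Sum>i=1..k. \<Sum>b'\<in>B. v b i h * h * a i l * M b b' (h * tau l) * e b' l h)"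
      by (intro sum.cong refl sum.swap)
    also have "\<dots> = (\<Sum>b\<in>B. \<Sum>l=1..k. \<Sum>b'\<in>B. \<Sum>i=1..k. v b i h * h * a i l * M b b' (h * tau l) * e b' l h)"
      by (intro sum.cong refl sum.swap)
    also have "\<dots> = (\<Sum>l=1..k. \<Sum>b\<in>B. \<Sum>b'\<in>B. \<Sum>i=1..k. v b i h * h * a i l * M b b' (h * tau l) * e b' l h)"
      by (rule sum.swap)
    also have "\<dots> = (\<Sum>l=1..k. \<Sum>b'\<in>B. \<Sum>b\<in>B. \<Sum>i=1..k. v b i h * h * a i l * M b b' (h * tau l) * e b' l h)"
      by (intro sum.cong refl sum.swap)
    also have "\<dots> = (\<Sum>b'\<in>B. \<Sum>l=1..k. \<Sum>b\<in>B. \<Sum>i=1..k. v b i h * h * a i l * M b b' (h * tau l) * e b' l h)"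
      by (rule sum.swap)
    also have "\<dots> = (\<Sum>b'\<in>B. \<Sum>l=1..k. u b' l h * e b' l h)"
      unfolding u_def by (simp add: sum_distrib_left sum_distrib_right mult_ac)
    finally show ?thesis .
  qed
  ultimately have X: "order_ge (at 0) (2 * s) (\<lambda>h. \<Sum>b\<in>B. \<Sum>i=1..k. v b i h * ?X b i h)"
    by simp
  have D: "order_ge (at 0) (2 * s) (\<lambda>h. \<Sum>b\<in>B. \<Sum>i=1..k. v b i h * d b i h)"
    by (intro order_ge_sum d step.prems(1))
  have "order_ge (at 0) (2 * s) (\<lambda>h. v b i h * (e b i h - d b i h - ?X b i h))"
    if "b \<in> B" "i \<in> {1..k}" for b i
    using order_ge_mult[OF graded_row_bounded[OF step.prems(1)[OF that(1)] that(2)] recursion[OF that]] by simp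
  then have R: "order_ge (at 0) (2 * s) (\<lambda>h. \<Sum>b\<in>B. \<Sum>i=1..k. v b i h * (e b i h - d b i h - ?X b i h))"
    by (intro order_ge_sum)
  show ?case
    by (rule order_ge_cong[OF order_ge_add[OF order_ge_add[OF R X] D]])
      (simp only: sum.distrib[symmetric] distrib_left[symmetric] diff_add_cancel eventually_True simp_thms)
qed

text \<open>The step error splits into the quadrature defect of the exact solution, handled by
  \<open>B(2s)\<close>, and \<open>h\<close> times the weighted sum of
  \<open>f (Y h i) - f (z (h * tau i))\<close>. The latter is linearised, and its linear part pairs
  the stage errors with graded rows. The limit hypothesis selects the stage solutions that stay near
  the initial value.\<close>

theorem runge_kutta_order:
  fixes f :: "'a::euclidean_space \<Rightarrow> 'a" and z :: "real \<Rightarrow> 'a" and Y :: "real \<Rightarrow> nat \<Rightarrow> 'a"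
  assumes "smooth f"
    and z: "\<forall>\<^sub>F x in nhds 0. (z has_vector_derivative f (z x)) (at x)"
    and stages: "\<forall>\<^sub>F h in at 0. \<forall>i\<in>{1..k}. Y h i = z 0 + h *\<^sub>R (\<Sum>l=1..k. a i l *\<^sub>R f (Y h l))"
    and lim: "\<forall>i\<in>{1..k}. ((\<lambda>h. Y h i) \<longlongrightarrow> z 0) (at 0)"
  shows "order_ge (at 0) (Suc (2 * s)) (\<lambda>h. z 0 + h *\<^sub>R (\<Sum>i=1..k. w i *\<^sub>R f (Y h i)) - z h)"
proof -
  obtain D where D0: "\<And>x. D 0 x [] = f x"
    and cont: "\<And>m vs. length vs = m \<Longrightarrow> continuous_on UNIV (\<lambda>x. D m x vs)"
    and deriv: "\<And>m vs x. length vs = m \<Longrightarrow> ((\<lambda>z. D m z vs) has_derivative (\<lambda>v. D (Suc m) x (v # vs))) (at x)"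
    using assms(1) unfolding smooth_def by metis
  have z': "\<forall>\<^sub>F x in nhds 0. (z has_vector_derivative D 0 (z x) []) (at x)"
    using z by (simp only: D0)
  have tay: "taylor n (\<lambda>x. D m (z x) vs)" if "length vs = m" for vs m n
    by (rule taylor_along_solution[of D, OF _ _ z' that]) (rule cont deriv, assumption)+
  have f': "(f has_derivative (\<lambda>v. D 1 x [v])) (at x)" for x
    using deriv[of "[]" 0 x] by (simp add: D0)

  obtain c where c: "order_ge (nhds 0) (2 * s) (\<lambda>x. f (z x) - (\<Sum>m<2 * s. x ^ m *\<^sub>R c m))"
    using tay[of "[]" 0 "2 * s"] by (auto simp: taylor_def D0)
  \<comment> \<open>One family of coefficients \<open>c\<close> serves all stages and the final
    step.\<close>
  note defect = quadrature_defect[OF c taylor_integrate_expansion[OF c z]]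
  define d where "d i h = z 0 + h *\<^sub>R (\<Sum>l=1..k. a i l *\<^sub>R f (z (h * tau l))) - z (h * tau i)" for i h
  have d: "order_ge (at 0) (Suc (2 * s)) (\<lambda>h. d i h - (\<Sum>p<2 * s. (h ^ Suc p * stage_defect i p) *\<^sub>R c p))" for i
    unfolding d_def stage_defect_def by (rule defect)
  have d_order: "order_ge (at 0) (Suc s) (d i)" if i: "i \<in> {1..k}" for i
  proof -
    have "order_ge (at 0) (Suc s) (\<lambda>h. (h ^ Suc p * stage_defect i p) *\<^sub>R c p)" for p
    \<comment> \<open>Below \<open>s\<close> the coefficient vanishes by \<open>C(s)\<close>; from
      \<open>s\<close> on, \<open>h ^ Suc p\<close> is small enough.\<close>
    proof (cases "p < s")
      case True
      then show ?thesis
        by (simp only: stage_defect_zero[OF i True] mult_zero_right scaleR_zero_left order_ge_zero)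
    next
      case False
      then show ?thesis
        by (intro order_ge_mono[OF order_ge_power_scaleR _ at_0_le_nhds_0]) simp
    qed
    then have sum: "order_ge (at 0) (Suc s) (\<lambda>h. \<Sum>p<2 * s. (h ^ Suc p * stage_defect i p) *\<^sub>R c p)"
      by (intro order_ge_sum)
    have "order_ge (at 0) (Suc s) (\<lambda>h. d i h - (\<Sum>p<2 * s. (h ^ Suc p * stage_defect i p) *\<^sub>R c p))"
      by (rule order_ge_mono[OF d _ at_0_le_nhds_0]) simp
    from order_ge_add[OF this sum] show ?thesis
      by (simp only: diff_add_cancel)
  qed

  define e where "e i h = Y h i - z (h * tau i)" for i h
  have z_lim: "((\<lambda>h. z (h * t)) \<longlongrightarrow> z 0) (at 0)" for t
  proof -
    have "isCont z 0"
      using eventually_nhds_x_imp_x[OF z] by (rule has_vector_derivative_continuous)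
    then have "isCont (\<lambda>h. z (h * t)) 0"
      by (intro isCont_o2[of _ "\<lambda>h. h * t" z] continuous_intros) simp
    then show ?thesis
      by (simp add: isCont_def)
  qed
  \<comment> \<open>A convex compact set that eventually contains the numerical and exact stages; on
    it \<open>f\<close> and its derivative have Lipschitz bounds.\<close>
  have ball: "\<forall>\<^sub>F h in at 0. \<forall>i\<in>{1..k}. Y h i \<in> cball (z 0) 1 \<and> z (h * tau i) \<in> cball (z 0) 1"
  proof (intro eventually_ball_finite ballI eventually_conj)
    fix i assume "i \<in> {1..k}"
    with lim have Y: "((\<lambda>h. Y h i) \<longlongrightarrow> z 0) (at 0)"
      by blast
    have cball: "\<forall>\<^sub>F h in at 0. u h \<in> cball (z 0) 1" if "(u \<longlongrightarrow> z 0) (at (0::real))" for u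
      using tendstoD[OF that zero_less_one] by eventually_elim (simp add: dist_commute)
    show "\<forall>\<^sub>F h in at 0. Y h i \<in> cball (z 0) 1" "\<forall>\<^sub>F h in at 0. z (h * tau i) \<in> cball (z 0) 1"
      by (intro cball Y z_lim)+
  qed simp

  obtain L where L: "L \<ge> 0"
      "\<And>u v. u \<in> cball (z 0) 1 \<Longrightarrow> v \<in> cball (z 0) 1 \<Longrightarrow> norm (f u - f v) \<le> L * norm (u - v)"
    using lipschitz_on_cball_of_continuous_derivative[OF f', of "z 0" 1] cont[of "[_]" 1] by auto
  have e_eq: "\<forall>\<^sub>F h in at 0. \<forall>i\<in>{1..k}.
      e i h = d i h + h *\<^sub>R (\<Sum>l=1..k. a i l *\<^sub>R (f (Y h l) - f (z (h * tau l))))"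
    using stages by eventually_elim (simp add: e_def d_def scaleR_diff_right sum_subtractf)
  have e_order: "order_ge (at 0) (Suc s) (e i)" if "i \<in> {1..k}" for i
  proof (rule order_ge_implicit[where I = "{1..k}" and d = d and K = "(\<Sum>i=1..k. \<Sum>l=1..k. \<bar>a i l\<bar>) * L"])
    let ?A = "\<Sum>i=1..k. \<Sum>l=1..k. \<bar>a i l\<bar>"
    show "0 \<le> ?A * L"
      using L(1) by (intro mult_nonneg_nonneg sum_nonneg) auto
    show "\<forall>\<^sub>F h in at 0. \<forall>i\<in>{1..k}. norm (e i h) \<le>
        norm (d i h) + \<bar>h\<bar> * (?A * L * (\<Sum>l=1..k. norm (e l h)))"
      using e_eq ball
    proof eventually_elim
      case (elim h)
      show ?case
      proof
        fix i assume i: "i \<in> {1..k}"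
        let ?S = "\<Sum>l=1..k. norm (e l h)"
        have "norm (a i l *\<^sub>R (f (Y h l) - f (z (h * tau l)))) \<le> ?A * (L * norm (e l h))"
          if l: "l \<in> {1..k}" for l
        proof -
          have "\<bar>a i l\<bar> \<le> (\<Sum>l=1..k. \<bar>a i l\<bar>)"
            using l by (intro member_le_sum) auto
          also have "\<dots> \<le> ?A"
            using i by (intro member_le_sum[of i "{1..k}" "\<lambda>i. \<Sum>l=1..k. \<bar>a i l\<bar>"]) (auto intro: sum_nonneg)
          finally have "\<bar>a i l\<bar> \<le> ?A" .
          moreover have "norm (f (Y h l) - f (z (h * tau l))) \<le> L * norm (e l h)"
            unfolding e_def using l elim(2) by (intro L(2)) auto
          ultimately show ?thesis
            unfolding norm_scaleR by (intro mult_mono) (auto intro: order.trans[OF abs_ge_zero])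
        qed
        then have "norm (\<Sum>l=1..k. a i l *\<^sub>R (f (Y h l) - f (z (h * tau l)))) \<le> (\<Sum>l=1..k. ?A * (L * norm (e l h)))"
          by (intro sum_norm_le) auto
        also have "\<dots> = ?A * L * ?S"
          by (simp only: sum_distrib_left[symmetric] mult.assoc)
        finally have "\<bar>h\<bar> * norm (\<Sum>l=1..k. a i l *\<^sub>R (f (Y h l) - f (z (h * tau l)))) \<le> \<bar>h\<bar> * (?A * L * ?S)"
          by (rule mult_left_mono) simp
        moreover have "norm (e i h) \<le> norm (d i h) +
            \<bar>h\<bar> * norm (\<Sum>l=1..k. a i l *\<^sub>R (f (Y h l) - f (z (h * tau l))))"
          using elim(1) i norm_triangle_ineq[of "d i h"] by (metis norm_scaleR)
        ultimately show "norm (e i h) \<le> norm (d i h) + \<bar>h\<bar> * (?A * L * ?S)"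
          by linarith
      qed
    qed
  qed (use that d_order in auto)

  \<comment> \<open>Second derivatives, from \<open>D 2\<close>, bound the variation of the first
    derivative in each fixed direction.\<close>
  have "\<exists>K\<ge>0. \<forall>u\<in>cball (z 0) 1. \<forall>v\<in>cball (z 0) 1. norm (D 1 u [b] - D 1 v [b]) \<le> K * norm (u - v)" for b
  proof -
    obtain K where "K \<ge> 0" "\<And>u v. u \<in> cball (z 0) 1 \<Longrightarrow> v \<in> cball (z 0) 1 \<Longrightarrow>
        norm (D 1 u [b] - D 1 v [b]) \<le> K * norm (u - v)"
      using lipschitz_on_cball_of_continuous_derivative[OF deriv[of "[b]" 1], of "z 0" 1] cont[of "[_, b]" 2]
      by (auto simp: numeral_2_eq_2)
    then show ?thesis by blast
  qed
  then obtain K where K: "\<And>b. K b \<ge> 0" "\<And>b u v. u \<in> cball (z 0) 1 \<Longrightarrow> v \<in> cball (z 0) 1 \<Longrightarrow>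
      norm (D 1 u [b] - D 1 v [b]) \<le> K b * norm (u - v)"
    by metis
  define r where "r i h = f (Y h i) - f (z (h * tau i)) - D 1 (z (h * tau i)) [e i h]" for i h
  \<comment> \<open>The linearisation error is quadratic in \<open>e i\<close>, hence of order 2 (s
    + 1).\<close>
  have r: "order_ge (at 0) (2 * s) (r i)" if i: "i \<in> {1..k}" for i
  proof -
    have "order_ge (at 0) (Suc s + Suc s) (\<lambda>h. norm (e i h) * norm (e i h))"
      by (intro order_ge_mult order_ge_norm e_order i)
    then have sq: "order_ge (at 0) (2 * s) (\<lambda>h. norm (e i h) * norm (e i h))"
      by (rule order_ge_mono[OF _ _ at_0_le_nhds_0]) simp
    have "\<forall>\<^sub>F h in at 0. norm (r i h) \<le> (\<Sum>b\<in>Basis. K b) * norm (norm (e i h) * norm (e i h))"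
      using ball
    proof eventually_elim
      case (elim h)
      have "norm (f (Y h i) - f (z (h * tau i)) - D 1 (z (h * tau i)) [Y h i - z (h * tau i)])
          \<le> (\<Sum>b\<in>Basis. K b) * (norm (Y h i - z (h * tau i)))\<^sup>2"
        by (rule quadratic_remainder_of_lipschitz_derivative[OF f', where p = "z 0" and r = 1])
          (use elim i K in blast)+
      then show ?case
        by (simp add: r_def e_def power2_eq_square)
    qed
    then show ?thesis
      by (rule order_ge_bound[OF sq]) (simp add: K sum_nonneg)
  qed

  \<comment> \<open>Jacobian entries along the solution. Coordinates are used because graded rows
    are scalar.\<close>
  define M where "M b b' x = D 1 (z x) [b'] \<bullet> b" for b b' x
  have M: "taylor s (M b b')" for b b'
    unfolding M_def by (intro taylor_bounded_linear[OF bounded_linear_inner_left] tay) simp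
  have f_diff: "(f (Y h l) - f (z (h * tau l))) \<bullet> b =
      r l h \<bullet> b + (\<Sum>b'\<in>Basis. M b b' (h * tau l) * (e l h \<bullet> b'))" for h l b
  proof -
    have "D 1 (z (h * tau l)) [e l h] = (\<Sum>b'\<in>Basis. (e l h \<bullet> b') *\<^sub>R D 1 (z (h * tau l)) [b'])"
      by (rule linear_eq_sum_Basis[OF has_derivative_linear[OF f']])
    moreover have "f (Y h l) - f (z (h * tau l)) = r l h + D 1 (z (h * tau l)) [e l h]"
      by (simp add: r_def)
    ultimately show ?thesis
      by (simp only: inner_add_left inner_sum_left inner_scaleR_left M_def mult.commute)
  qed

  have pairing: "order_ge (at 0) (2 * s) (\<lambda>h. \<Sum>b\<in>Basis. \<Sum>i=1..k. v b i h * (e i h \<bullet> b))"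
    if v: "\<And>b. b \<in> Basis \<Longrightarrow> graded_row (v b)" for v :: "'a \<Rightarrow> nat \<Rightarrow> real \<Rightarrow> real"
  \<comment> \<open>With \<open>n = 0\<close> the starting row need only be bounded, which every
    graded row is.\<close>
  proof (rule graded_row_error[where d = "\<lambda>b i h. d i h \<bullet> b" and M = M and n = 0])
    fix b :: 'a and i assume b: "b \<in> Basis" and i: "i \<in> {1..k}"
    show "order_ge (at 0) (Suc s) (\<lambda>h. e i h \<bullet> b)"
      by (intro order_ge_bounded_linear[OF bounded_linear_inner_left] e_order i)
    \<comment> \<open>What the linear recursion leaves out is exactly \<open>h\<close> times the
      matrix applied to the remainders \<open>r\<close>.\<close>
    have "order_ge (at 0) (1 + 2 * s) (\<lambda>h. h ^ 1 * (\<Sum>l=1..k. (a i l *\<^sub>R r l h) \<bullet> b))"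
      by (intro order_ge_mult order_ge_power order_ge_sum
          order_ge_bounded_linear[OF bounded_linear_inner_left] order_ge_scaleR_const r)
    then have "order_ge (at 0) (2 * s) (\<lambda>h. h ^ 1 * (\<Sum>l=1..k. (a i l *\<^sub>R r l h) \<bullet> b))"
      by (rule order_ge_mono[OF _ _ at_0_le_nhds_0]) simp
    then show "order_ge (at 0) (2 * s) (\<lambda>h. e i h \<bullet> b - d i h \<bullet> b
        - h * (\<Sum>l=1..k. a i l * (\<Sum>b'\<in>Basis. M b b' (h * tau l) * (e l h \<bullet> b'))))"
    proof (rule order_ge_cong)
      show "\<forall>\<^sub>F h in at 0. h ^ 1 * (\<Sum>l=1..k. (a i l *\<^sub>R r l h) \<bullet> b) = e i h \<bullet> b - d i h \<bullet> b
        - h * (\<Sum>l=1..k. a i l * (\<Sum>b'\<in>Basis. M b b' (h * tau l) * (e l h \<bullet> b')))"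
        using e_eq
      proof eventually_elim
        case (elim h)
        then have "e i h \<bullet> b = d i h \<bullet> b + h * (\<Sum>l=1..k. a i l * ((f (Y h l) - f (z (h * tau l))) \<bullet> b))"
          using i by (simp only: inner_add_left inner_scaleR_left inner_sum_left)
        then show ?case
          unfolding f_diff by (simp add: distrib_left sum.distrib)
      qed
    qed
    show "order_ge (at 0) 0 (v b i)"
      by (rule graded_row_bounded[OF v[OF b] i])
  next
    fix b :: 'a and u assume "graded_row u"
    then have "order_ge (at 0) (2 * s) (\<lambda>h. (\<Sum>i=1..k. u i h *\<^sub>R d i h) \<bullet> b)"
      by (intro order_ge_bounded_linear[OF bounded_linear_inner_left] graded_row_defect[OF _ d d_order])
    then show "order_ge (at 0) (2 * s) (\<lambda>h. \<Sum>i=1..k. u i h * (d i h \<bullet> b))"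
      by (simp only: inner_sum_left inner_scaleR_left)
  qed (use v M in auto)

  have "order_ge (at 0) (2 * s) (\<lambda>h. (\<Sum>i=1..k. w i *\<^sub>R (f (Y h i) - f (z (h * tau i)))) \<bullet> b)" for b
  proof -
    \<comment> \<open>The weights alone are the monomial row of degree 0 with coefficient 1;
      multiplying by a Jacobian entry keeps the row graded.\<close>
    have "graded_row (\<lambda>i h. 1 * (w i * (h * tau i) ^ 0) * M b b' (h * tau i))" for b'
      by (intro graded_row_times_taylor graded_row.monomial order_ge_const M)
    then have "graded_row (\<lambda>i h. w i * M b b' (h * tau i))" for b'
      by simp
    then have 1: "order_ge (at 0) (2 * s) (\<lambda>h. \<Sum>b'\<in>Basis. \<Sum>i=1..k. w i * M b b' (h * tau i) * (e i h \<bullet> b'))"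
      by (intro pairing)
    have 2: "order_ge (at 0) (2 * s) (\<lambda>h. \<Sum>i=1..k. (w i *\<^sub>R r i h) \<bullet> b)"
      by (intro order_ge_sum order_ge_bounded_linear[OF bounded_linear_inner_left] order_ge_scaleR_const r)
    have "(\<Sum>i=1..k. (w i *\<^sub>R r i h) \<bullet> b) + (\<Sum>b'\<in>Basis. \<Sum>i=1..k. w i * M b b' (h * tau i) * (e i h \<bullet> b')) =
        (\<Sum>i=1..k. w i *\<^sub>R (f (Y h i) - f (z (h * tau i)))) \<bullet> b" for h
      unfolding inner_sum_left inner_scaleR_left f_diff
      by (subst sum.swap) (simp add: distrib_left sum.distrib sum_distrib_left mult_ac)
    with order_ge_add[OF 2 1] show ?thesis
      by simp
  qed
  then have "order_ge (at 0) (2 * s) (\<lambda>h. \<Sum>b\<in>Basis.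
      ((\<Sum>i=1..k. w i *\<^sub>R (f (Y h i) - f (z (h * tau i)))) \<bullet> b) *\<^sub>R b)"
    by (intro order_ge_sum order_ge_bounded_linear[OF bounded_linear_scaleR_left])
  then have "order_ge (at 0) (2 * s) (\<lambda>h. \<Sum>i=1..k. w i *\<^sub>R (f (Y h i) - f (z (h * tau i))))"
    by (simp only: euclidean_representation)
  from order_ge_scaleR[OF order_ge_power[of _ 1] this]
  have stage_part: "order_ge (at 0) (Suc (2 * s)) (\<lambda>h. h *\<^sub>R (\<Sum>i=1..k. w i *\<^sub>R (f (Y h i) - f (z (h * tau i)))))"
    by simp
  \<comment> \<open>At \<open>\<theta> = 1\<close>, \<open>B(2s)\<close> annihilates all explicit
    defect coefficients, leaving only the remainder.\<close>
  have "(\<Sum>m<2 * s. (h ^ Suc m * ((\<Sum>i=1..k. w i * tau i ^ m) - 1 ^ Suc m / real (Suc m))) *\<^sub>R c m) = 0" for h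
    by (intro sum.neutral ballI)
      (simp only: lessThan_iff quadrature power_one diff_self mult_zero_right scaleR_zero_left)
  then have "order_ge (at 0) (Suc (2 * s)) (\<lambda>h. z 0 + h *\<^sub>R (\<Sum>i=1..k. w i *\<^sub>R f (z (h * tau i))) - z h)"
    using defect[of w tau "{1..k}" 1] by (simp only: diff_0_right mult_1_right)
  from order_ge_add[OF stage_part this] show ?thesis
    by (simp add: scaleR_diff_right sum_subtractf algebra_simps)
qed

end

section \<open>Order of HBVM\<close>

theorem theorem1p1:
  fixes k s :: nat and tau :: "nat \<Rightarrow> real" and fund :: "nat set"
    and f :: "'a::euclidean_space \<Rightarrow> 'a" and y0 :: 'a and t0 \<delta> :: real
    and y :: "real \<Rightarrow> 'a" and Y :: "real \<Rightarrow> nat \<Rightarrow> 'a"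
  assumes "1 \<le> s" and "s \<le> k"
    and "inj_on tau {1..k}" and "\<forall>i\<in>{1..k}. tau i \<in> {0..1}"
    and "quad_exact_upto k tau (2 * s - 1)"
    and "fund \<subseteq> {1..k}" and "card fund = s"
    and "smooth f"
    and "\<delta> > 0" and "y t0 = y0"
    and "\<forall>t\<in>{t0 - \<delta> <..< t0 + \<delta>}. (y has_vector_derivative f (y t)) (at t)"
    and "eventually (\<lambda>h. hbvm_stages k s tau f y0 h (Y h)) (at 0)"
    and "\<forall>i\<in>{1..k}. ((\<lambda>h. Y h i) \<longlongrightarrow> y0) (at 0)"
  shows "(\<lambda>h. norm (hbvm_step k tau f y0 h (Y h) - y (t0 + h))) \<in> O[at 0](\<lambda>h. h ^ (2 * s + 1))"
proof -
  have tau: "0 \<le> tau i" if "i \<in> {1..k}" for i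
    using that assms(4) by auto
  interpret simplifying_assumptions k s tau "quad_weight k tau" "hbvm_matrix k s tau"
  proof
    fix m assume "m < 2 * s"
    then show "(\<Sum>i=1..k. quad_weight k tau i * tau i ^ m) = 1 / Suc m"
      by (intro quad_exact_power[OF assms(5)]) simp
  next
    fix i m assume "i \<in> {1..k}" "m < s"
    then show "(\<Sum>l=1..k. hbvm_matrix k s tau i l * tau l ^ m) = tau i ^ Suc m / Suc m"
      by (intro hbvm_matrix_power[OF assms(5)] tau)
  next
    fix l m assume "Suc m < s"
    then show "(\<Sum>i=1..k. quad_weight k tau i * tau i ^ m * hbvm_matrix k s tau i l) =
        quad_weight k tau l * (1 - tau l ^ Suc m) / Suc m"
      by (intro hbvm_matrix_weight_power[OF assms(5)] tau)
  qed
  \<comment> \<open>The solution is translated so that the initial time becomes 0;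
    \<open>t0 + 0\<close> stays unsimplified below to match \<open>z 0\<close>.\<close>
  have "\<forall>\<^sub>F x in nhds 0. ((\<lambda>x. y (t0 + x)) has_vector_derivative f (y (t0 + x))) (at x)"
    unfolding eventually_nhds_metric
  proof (intro exI[of _ \<delta>] conjI allI impI)
    fix x :: real assume "dist x 0 < \<delta>"
    then have "(y has_vector_derivative f (y (t0 + x))) (at (t0 + x))"
      by (intro bspec[OF assms(11)]) (auto simp: dist_real_def)
    moreover have "((\<lambda>x. t0 + x) has_vector_derivative 1) (at x)"
      by (auto intro!: derivative_eq_intros)
    ultimately show "((\<lambda>x. y (t0 + x)) has_vector_derivative f (y (t0 + x))) (at x)"
      using vector_diff_chain_at[of "\<lambda>x. t0 + x" 1 x y] by (simp add: o_def)
  qed (rule assms(9))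
  moreover have "\<forall>\<^sub>F h in at 0. \<forall>i\<in>{1..k}.
      Y h i = y (t0 + 0) + h *\<^sub>R (\<Sum>l=1..k. hbvm_matrix k s tau i l *\<^sub>R f (Y h l))"
    using assms(12)
  proof eventually_elim
    case (elim h)
    \<comment> \<open>Interchanging the sums over \<open>j\<close> and \<open>l\<close> rewrites the
      stages in Butcher form.\<close>
    have eq: "(\<Sum>l=1..k. hbvm_matrix k s tau i l *\<^sub>R f (Y h l)) =
        (\<Sum>j=1..s. integral {0..tau i} (legP j) *\<^sub>R
          (\<Sum>l=1..k. (quad_weight k tau l * legP j (tau l)) *\<^sub>R f (Y h l)))" for i
      unfolding hbvm_matrix_def scaleR_sum_left scaleR_sum_right by (subst sum.swap) simp
    show ?case
      using elim unfolding hbvm_stages_def eq add_0_right assms(10) .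
  qed
  moreover have "\<forall>i\<in>{1..k}. ((\<lambda>h. Y h i) \<longlongrightarrow> y (t0 + 0)) (at 0)"
    using assms(10,13) by simp
  ultimately have "order_ge (at 0) (Suc (2 * s))
      (\<lambda>h. y (t0 + 0) + h *\<^sub>R (\<Sum>i=1..k. quad_weight k tau i *\<^sub>R f (Y h i)) - y (t0 + h))"
    by (rule runge_kutta_order[OF assms(8)])
  then obtain C where "\<forall>\<^sub>F h in at 0. norm (hbvm_step k tau f y0 h (Y h) - y (t0 + h)) \<le> C * \<bar>h\<bar> ^ Suc (2 * s)"
    using assms(10) by (auto simp: order_ge_def hbvm_step_def)
  then show ?thesis
    by (intro bigoI[of _ C]) (simp add: power_abs abs_mult)
qed

end
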